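(* For all $k\in\mathbb{N}$ and $\varepsilon>0$ there exists $n_0>0$ such that for all $n>n_0$, \[ \left\|\frac{1_{\mathcal{U}_{2n}}}{\mathbb{E}[1_{\mathcal{U}_{2n}}]}-\frac{1_{\mathcal{D}_{2n,k}}}{\mathbb{E}[1_{\mathcal{D}_{2n,k}}]}\right\|_{U_k}\leq\varepsilon . \]
   Context: $\mathcal{U}_{2n}=\{x\in\{0,1\}^{2n}:|x|=n\}$, where $|x|$ is the Hamming weight. For $k\in\mathbb{N}$, let $a$ be such that $n\equiv a \pmod{2^{k-1}}$, and $\mathcal{D}_{2n,k}=\{x\in\{0,1\}^{2n}: |x|\equiv a \pmod{2^{k-1}}\}$. Expectations are with respect to the uniform measure on $\{0,1\}^{2n}$, and $1_A$ is the indicator of $A$. For an integer $s\ge1$ and $F\colon\{0,1\}^{m}\to\mathbb{C}$, the Gowers uniformity norm is \[ \|F\|_{U_s}=\Big(\mathbb{E}_{x,h_1,\dots,h_s\in\{0,1\}^m}\prod_{T\subseteq[s]}C^{|T|}F\big(x\oplus\textstyle\bigoplus_{i\in T}h_i\big)\Big)^{1/2^s}, \] with $x,h_i$ uniform and independent and $C$ denoting complex conjugation. *)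

theory Defs
  imports Complex_Main "HOL-Library.FuncSet" "HOL-Library.Indicator_Function"
    "HOL-Library.Z2" "HOL-Number_Theory.Cong"
begin

text \<open>
  The cube \<open>{0,1}\<^sup>m\<close> is encoded by the sequences of bits that vanish from
  position \<open>m\<close> onwards. The type \<^typ>\<open>bit\<close> is the two-element field, so that
  exclusive-or of points is pointwise addition.
\<close>

definition cube :: "nat \<Rightarrow> (nat \<Rightarrow> bit) set" where
  "cube m = {x. \<forall>i\<ge>m. x i = 0}"

lemma card_cube: "card (cube m) = 2 ^ m"
  and finite_cube: "finite (cube m)"
proof -
  have bij: "bij_betw (\<lambda>A i. of_bool (i \<in> A) :: bit) (Pow {..<m}) (cube m)"
    by (rule bij_betwI[where g = "\<lambda>x. {i. x i = 1}"])
      (auto simp: cube_def fun_eq_iff not_less[symmetric])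
  show "card (cube m) = 2 ^ m"
    using bij_betw_same_card[OF bij] by (simp add: card_Pow)
  show "finite (cube m)"
    using bij_betw_finite[OF bij] by simp
qed

definition hamming_weight :: "nat \<Rightarrow> (nat \<Rightarrow> bit) \<Rightarrow> nat" where
  "hamming_weight m x = card {i. i < m \<and> x i = 1}"

definition middle_slice :: "nat \<Rightarrow> (nat \<Rightarrow> bit) set" where
  "middle_slice n = {x \<in> cube (2 * n). hamming_weight (2 * n) x = n}"

definition mod_slice :: "nat \<Rightarrow> nat \<Rightarrow> int \<Rightarrow> (nat \<Rightarrow> bit) set" where
  "mod_slice n k a =
     {x \<in> cube (2 * n). [int (hamming_weight (2 * n) x) = a] (mod 2 ^ (k - 1))}"

definition uniform_avg :: "'a set \<Rightarrow> ('a \<Rightarrow> complex) \<Rightarrow> complex" where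
  "uniform_avg A f = (\<Sum>x\<in>A. f x) / of_nat (card A)"

text \<open>
  For \<open>s \<ge> 1\<close> the average below is a nonnegative real number, viewed as an element
  of \<^typ>\<open>complex\<close>; \<^const>\<open>cmod\<close> only serves to transport it to \<^typ>\<open>real\<close>.
\<close>

definition gowers_norm :: "nat \<Rightarrow> nat \<Rightarrow> ((nat \<Rightarrow> bit) \<Rightarrow> complex) \<Rightarrow> real" where
  "gowers_norm m s F =
     root (2 ^ s) (cmod (uniform_avg (cube m \<times> ({1..s} \<rightarrow>\<^sub>E cube m))
       (\<lambda>(x, h). \<Prod>T\<in>Pow {1..s}. (cnj ^^ card T) (F (\<lambda>i. x i + (\<Sum>j\<in>T. h j i))))))"

definition normalized_indicator ::
    "nat \<Rightarrow> (nat \<Rightarrow> bit) set \<Rightarrow> (nat \<Rightarrow> bit) \<Rightarrow> complex" where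
  "normalized_indicator m A x = indicator A x / uniform_avg (cube m) (indicator A)"

end

theory Submission
  imports Defs "HOL-Analysis.Convex" "HOL-Analysis.Elementary_Normed_Spaces"
    "HOL-Real_Asymp.Real_Asymp"
begin

text \<open>
  Let \<open>u\<close> and \<open>d\<close> be the two normalized indicators. If \<open>\<parallel>u\<parallel>\<close> and \<open>\<parallel>d\<parallel>\<close>, raised to the power
  \<open>2\<^sup>k\<close>, and the Gowers product \<open>\<langle>u, d, \<dots>, d\<rangle>\<close> have a common limit \<open>C\<close>, then \<open>\<parallel>u - d\<parallel> \<longlonglongrightarrow> 0\<close>
  by uniform convexity: a Clarkson inequality bounds \<open>\<parallel>u + d\<parallel>\<close> and \<open>\<parallel>u - d\<parallel>\<close> together from
  above, while pairing \<open>u + d\<close> with \<open>d\<close> bounds \<open>\<parallel>u + d\<parallel>\<close> from below. Both follow from the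
  Gowers--Cauchy--Schwarz inequality. For \<open>u\<close> only the upper bound by \<open>C\<close> is needed.

  The products involving \<open>d\<close> are expanded in characters modulo \<open>2\<^sup>k\<^sup>-\<^sup>1\<close>; all terms decay
  exponentially except those of the relations modulo \<open>2\<^sup>k\<^sup>-\<^sup>1\<close> between the weights of the
  vertices of a parallelepiped, and \<open>C\<close> is the number of these relations.

  For \<open>u\<close>, group the coordinates by the set of directions that flip them. By Fourier
  inversion all vertices of a parallelepiped lie in the middle slice iff its base point is
  balanced on each of the \<open>2\<^sup>k\<close> groups. The group sizes concentrate at \<open>2n / 2\<^sup>k\<close> and are all even
  with probability about \<open>2 / 2\<^sup>P\<close>, where \<open>P = 2\<^sup>k\<close>, so central binomial estimates give the limit.
\<close>

section \<open>Gowers products\<close>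

declare add_bit_eq_xor [simp del]

text \<open>One real function per vertex, since both densities are real and conjugation then does
  nothing. The sum is unnormalized; the factor \<open>2 ^ (m * (card K + 1))\<close> is divided out
  only when limits are taken. An arbitrary set \<open>K\<close> of directions allows directions to
  be added and removed.\<close>

definition gowers_sum ::
    "nat \<Rightarrow> nat set \<Rightarrow> (nat set \<Rightarrow> (nat \<Rightarrow> bit) \<Rightarrow> real) \<Rightarrow> real" where
  "gowers_sum m K g =
     (\<Sum>x\<in>cube m. \<Sum>h\<in>K \<rightarrow>\<^sub>E cube m. \<Prod>T\<in>Pow K. g T (\<lambda>i. x i + (\<Sum>j\<in>T. h j i)))"

lemma cube_add: "x \<in> cube m \<Longrightarrow> y \<in> cube m \<Longrightarrow> (\<lambda>i. x i + y i) \<in> cube m"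
  by (simp add: cube_def)

lemma bit_add_cancel: "x + (x + y) = (y :: bit)"
  by (cases x; cases y) (auto simp: add_bit_eq_xor)

lemma sum_cube_shift:
  assumes "x \<in> cube m"
  shows "(\<Sum>y\<in>cube m. f y) = (\<Sum>y\<in>cube m. f (\<lambda>i. x i + y i))"
  by (rule sum.reindex_bij_witness[of _ "\<lambda>y i. x i + y i" "\<lambda>y i. x i + y i"])
    (use assms in \<open>auto simp: cube_add bit_add_cancel\<close>)

lemma gowers_sum_cong:
  assumes "\<And>T. T \<subseteq> K \<Longrightarrow> g T = g' T"
  shows "gowers_sum m K g = gowers_sum m K g'"
  unfolding gowers_sum_def using assms by (intro sum.cong prod.cong refl) auto

definition face_sum ::
    "nat \<Rightarrow> nat set \<Rightarrow> (nat set \<Rightarrow> (nat \<Rightarrow> bit) \<Rightarrow> real) \<Rightarrow> (nat \<Rightarrow> nat \<Rightarrow> bit) \<Rightarrow> real" where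
  "face_sum m K g h = (\<Sum>x\<in>cube m. \<Prod>T\<in>Pow K. g T (\<lambda>i. x i + (\<Sum>j\<in>T. h j i)))"

lemma face_sum_cong:
  assumes "\<And>T. T \<subseteq> K \<Longrightarrow> g T = g' T"
  shows "face_sum m K g = face_sum m K g'"
  unfolding face_sum_def using assms by (intro ext sum.cong prod.cong refl) auto

text \<open>The vertices avoiding \<open>j\<close> and those containing \<open>j\<close> form two
  opposite faces with the same directions from \<open>K\<close>, based at \<open>x\<close> and at
  \<open>x + y\<close>, where \<open>y\<close> is the direction \<open>j\<close>. As
  \<open>y\<close> is free, the two base points vary independently and the sum factorizes.\<close>

lemma gowers_sum_insert:
  assumes "finite K" "j \<notin> K"
  shows "gowers_sum m (insert j K) g =
    (\<Sum>h\<in>K \<rightarrow>\<^sub>E cube m. face_sum m K g h * face_sum m K (\<lambda>T. g (insert j T)) h)"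
proof -
  let ?s = "\<lambda>T x h i. x i + (\<Sum>j\<in>T. h j i) :: bit"
  have split: "(\<Prod>T\<in>Pow (insert j K). g T (?s T x (h(j := y)))) =
      (\<Prod>T\<in>Pow K. g T (?s T x h)) * (\<Prod>T\<in>Pow K. g (insert j T) (?s T (\<lambda>i. x i + y i) h))"
    for x y and h :: "nat \<Rightarrow> nat \<Rightarrow> bit"
  proof -
    have inj: "inj_on (insert j) (Pow K)"
      using assms by (auto simp: inj_on_def)
    have disj: "Pow K \<inter> insert j ` Pow K = {}"
      using assms by auto
    have off: "(\<Sum>l\<in>T. (h(j := y)) l i) = (\<Sum>l\<in>T. h l i)" if "T \<in> Pow K" for T i
      using that assms by (intro sum.cong) auto
    have on: "(\<Sum>l\<in>insert j T. (h(j := y)) l i) = y i + (\<Sum>l\<in>T. h l i)" if "T \<in> Pow K" for T i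
    proof -
      have "j \<notin> T" "finite T"
        using that assms by (auto dest: finite_subset)
      then show ?thesis
        using off[OF that, of i] by simp
    qed
    have "(\<Prod>T\<in>Pow (insert j K). g T (?s T x (h(j := y)))) =
        (\<Prod>T\<in>Pow K. g T (?s T x (h(j := y)))) *
        (\<Prod>T\<in>insert j ` Pow K. g T (?s T x (h(j := y))))"
      unfolding Pow_insert using assms disj by (intro prod.union_disjoint) auto
    also have "(\<Prod>T\<in>insert j ` Pow K. g T (?s T x (h(j := y)))) =
        (\<Prod>T\<in>Pow K. g (insert j T) (?s (insert j T) x (h(j := y))))"
      using inj by (simp add: prod.reindex)
    also have "\<dots> = (\<Prod>T\<in>Pow K. g (insert j T) (?s T (\<lambda>i. x i + y i) h))"
      by (intro prod.cong refl) (simp only: on add.assoc)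
    also have "(\<Prod>T\<in>Pow K. g T (?s T x (h(j := y)))) = (\<Prod>T\<in>Pow K. g T (?s T x h))"
      by (intro prod.cong refl) (simp only: off)
    finally show ?thesis .
  qed
  have "gowers_sum m (insert j K) g =
      (\<Sum>x\<in>cube m. \<Sum>(y, h)\<in>cube m \<times> (K \<rightarrow>\<^sub>E cube m).
        \<Prod>T\<in>Pow (insert j K). g T (?s T x (h(j := y))))"
    unfolding gowers_sum_def PiE_insert_eq using inj_combinator[OF assms(2)]
    by (subst sum.reindex) (auto simp: case_prod_unfold intro!: sum.cong)
  also have "\<dots> = (\<Sum>x\<in>cube m. \<Sum>y\<in>cube m. \<Sum>h\<in>K \<rightarrow>\<^sub>E cube m.
      (\<Prod>T\<in>Pow K. g T (?s T x h)) * (\<Prod>T\<in>Pow K. g (insert j T) (?s T (\<lambda>i. x i + y i) h)))"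
    by (simp only: split sum.cartesian_product[symmetric])
  also have "\<dots> = (\<Sum>h\<in>K \<rightarrow>\<^sub>E cube m. \<Sum>x\<in>cube m. \<Sum>y\<in>cube m.
      (\<Prod>T\<in>Pow K. g T (?s T x h)) * (\<Prod>T\<in>Pow K. g (insert j T) (?s T (\<lambda>i. x i + y i) h)))"
    by (subst sum.swap[of _ "K \<rightarrow>\<^sub>E cube m"], subst sum.swap[of _ "K \<rightarrow>\<^sub>E cube m"]) simp
  also have "\<dots> = (\<Sum>h\<in>K \<rightarrow>\<^sub>E cube m. \<Sum>x\<in>cube m.
      (\<Prod>T\<in>Pow K. g T (?s T x h)) * face_sum m K (\<lambda>T. g (insert j T)) h)"
    unfolding face_sum_def sum_distrib_left[symmetric]
    by (intro sum.cong refl arg_cong2[where f = times] sum_cube_shift[symmetric])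
  finally show ?thesis
    by (simp add: face_sum_def sum_distrib_right)
qed

text \<open>With equal functions at all vertices two opposite faces have the same sum, so the Gowers
  product is a sum of squares. At least one direction is required for this.\<close>

lemma gowers_sum_const_nonneg:
  assumes "finite K" "K \<noteq> {}"
  shows "0 \<le> gowers_sum m K (\<lambda>_. f)"
proof -
  obtain j where "j \<in> K"
    using assms by auto
  then have K: "insert j (K - {j}) = K"
    by auto
  have "0 \<le> gowers_sum m (insert j (K - {j})) (\<lambda>_. f)"
    using assms by (subst gowers_sum_insert) (auto intro: sum_nonneg)
  then show ?thesis
    unfolding K .
qed

text \<open>By \<open>gowers_sum_insert\<close> the left side is the square of an inner product of
  the sums over two opposite faces. The factors on the right are the squared lengths: each places
  the functions of one face on both.\<close>

lemma gowers_sum_Cauchy_Schwarz: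
  assumes "finite K" "j \<in> K"
  shows "(gowers_sum m K g)\<^sup>2 \<le>
    gowers_sum m K (\<lambda>T. g (T - {j})) * gowers_sum m K (\<lambda>T. g (insert j T))"
proof -
  define L where "L = K - {j}"
  have L: "finite L" "j \<notin> L" "K = insert j L"
    using assms by (auto simp: L_def)
  have [simp]: "face_sum m L (\<lambda>T. g (T - {j})) = face_sum m L g"
    using L by (intro face_sum_cong arg_cong[where f = g]) auto
  show ?thesis
    unfolding L(3) gowers_sum_insert[OF L(1,2)]
    using Cauchy_Schwarz_ineq_sum[of "face_sum m L g" "face_sum m L (\<lambda>T. g (insert j T))"]
    using L by (simp add: power2_eq_square insert_absorb)
qed

text \<open>
  The Gowers--Cauchy--Schwarz inequality. The induction is over the set \<open>J\<close> of directions
  on which the family may depend; a Cauchy--Schwarz step in the direction \<open>j\<close> bounds the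
  sum by sums over two families that no longer depend on \<open>j\<close>.
\<close>

lemma gowers_Cauchy_Schwarz_aux:
  assumes "finite J" "J \<subseteq> K" "finite K" "K \<noteq> {}"
    and "\<And>T. T \<subseteq> K \<Longrightarrow> gowers_sum m K (\<lambda>_. g T) \<le> B"
    and "\<And>T. T \<subseteq> K \<Longrightarrow> g T = g (T \<inter> J)"
  shows "\<bar>gowers_sum m K g\<bar> \<le> B"
  using assms
proof (induction J arbitrary: g rule: finite_induct)
  case empty
  have "gowers_sum m K g = gowers_sum m K (\<lambda>_. g {})"
    using empty.prems(5) by (intro gowers_sum_cong) (metis Int_empty_right)
  then show ?case
    using empty.prems(4)[of "{}"] gowers_sum_const_nonneg[of K m "g {}"] empty.prems(2,3) by simp
next
  case (insert j J)
  have "\<bar>gowers_sum m K (\<lambda>T. g (T - {j}))\<bar> \<le> B"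
  proof (rule insert.IH)
    fix T assume T: "T \<subseteq> K"
    have "g (T - {j}) = g ((T - {j}) \<inter> insert j J)"
      using T by (intro insert.prems(5)) auto
    also have "(T - {j}) \<inter> insert j J = T \<inter> J - {j}"
      using insert.hyps by auto
    finally show "g (T - {j}) = g (T \<inter> J - {j})" .
    show "gowers_sum m K (\<lambda>_. g (T - {j})) \<le> B"
      using T by (intro insert.prems(4)) auto
  qed (use insert.prems(1,2,3) in auto)
  moreover have "\<bar>gowers_sum m K (\<lambda>T. g (insert j T))\<bar> \<le> B"
  proof (rule insert.IH)
    fix T assume T: "T \<subseteq> K"
    have "g (insert j T) = g (insert j T \<inter> insert j J)"
      using T insert.prems(1) by (intro insert.prems(5)) auto
    then show "g (insert j T) = g (insert j (T \<inter> J))"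
      by simp
    show "gowers_sum m K (\<lambda>_. g (insert j T)) \<le> B"
      using T insert.prems(1) by (intro insert.prems(4)) auto
  qed (use insert.prems(1,2,3) in auto)
  ultimately have "\<bar>gowers_sum m K (\<lambda>T. g (T - {j}))\<bar> * \<bar>gowers_sum m K (\<lambda>T. g (insert j T))\<bar> \<le> B * B"
    by (intro mult_mono) auto
  moreover have "(gowers_sum m K g)\<^sup>2 \<le>
      gowers_sum m K (\<lambda>T. g (T - {j})) * gowers_sum m K (\<lambda>T. g (insert j T))"
    using insert.prems(1,2) by (intro gowers_sum_Cauchy_Schwarz) auto
  ultimately have "(gowers_sum m K g)\<^sup>2 \<le> B\<^sup>2"
    by (simp add: power2_eq_square abs_mult[symmetric])
  moreover have "0 \<le> B"
    using insert.prems(4)[of "{}"] gowers_sum_const_nonneg[of K m "g {}"] insert.prems(2,3) by auto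
  ultimately show ?case
    using abs_le_square_iff[of "gowers_sum m K g" B] by simp
qed

text \<open>For \<open>J = K\<close> the condition on the dependence of the family is vacuous. A
  common bound \<open>B\<close> stands in for the product of the norms, which avoids roots.\<close>

lemma gowers_Cauchy_Schwarz:
  assumes "finite K" "K \<noteq> {}" "\<And>T. T \<subseteq> K \<Longrightarrow> gowers_sum m K (\<lambda>_. g T) \<le> B"
  shows "\<bar>gowers_sum m K g\<bar> \<le> B"
  by (rule gowers_Cauchy_Schwarz_aux[of K]) (use assms in \<open>auto simp: Int_absorb2\<close>)

section \<open>Uniform convexity of the Gowers norm\<close>

lemma gowers_sum_scale:
  assumes "finite K"
  shows "gowers_sum m K (\<lambda>T y. c * f y) = c ^ 2 ^ card K * gowers_sum m K (\<lambda>_. f)"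
  unfolding gowers_sum_def using assms
  by (simp add: prod.distrib card_Pow sum_distrib_left)

text \<open>
  A Clarkson type inequality: the products with an odd number of factors \<open>v\<close> cancel, and
  each of the others is at most \<open>B\<close>.
\<close>

lemma gowers_sum_add_diff:
  assumes "finite K" "K \<noteq> {}" "gowers_sum m K (\<lambda>_. u) \<le> B" "gowers_sum m K (\<lambda>_. v) \<le> B"
  shows "gowers_sum m K (\<lambda>_ y. u y + v y) + gowers_sum m K (\<lambda>_ y. u y - v y) \<le> 2 ^ 2 ^ card K * B"
proof -
  define fam where "fam = (\<lambda>(X :: nat set set) T. if T \<in> X then u else v)"
  \<comment> \<open>The joint coefficient of a product in the two expansions: 2 if the number of
    factors \<open>v\<close> is even, and 0 if it is odd.\<close>
  define c :: "nat set set \<Rightarrow> real" where "c = (\<lambda>X. 1 + (- 1) ^ (card (Pow K) - card X))"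
  let ?P = "Pow (Pow K)"
  have fin: "finite (Pow K)"
    using assms by simp
  have expand: "(\<Prod>T\<in>Pow K. a T + b T) + (\<Prod>T\<in>Pow K. a T - b T) =
      (\<Sum>X\<in>?P. c X * (\<Prod>T\<in>Pow K. if T \<in> X then a T else b T))" for a b :: "nat set \<Rightarrow> real"
  proof -
    have eq: "(\<Prod>T\<in>X. a T) * (\<Prod>T\<in>Pow K - X. b T) = (\<Prod>T\<in>Pow K. if T \<in> X then a T else b T)"
      if "X \<in> ?P" for X
      using that fin
      by (subst prod.If_cases) (auto simp: Int_absorb1 Diff_eq intro!: arg_cong2[where f = times] prod.cong)
    show ?thesis
      unfolding prod_add[OF fin] prod_diff_conv_sum'[OF fin] sum.distrib[symmetric]
      by (intro sum.cong refl) (auto simp: c_def algebra_simps eq[symmetric])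
  qed
  have "gowers_sum m K (\<lambda>_ y. u y + v y) + gowers_sum m K (\<lambda>_ y. u y - v y) =
      (\<Sum>x\<in>cube m. \<Sum>h\<in>K \<rightarrow>\<^sub>E cube m. \<Sum>X\<in>?P. c X *
        (\<Prod>T\<in>Pow K. fam X T (\<lambda>i. x i + (\<Sum>j\<in>T. h j i))))"
    unfolding gowers_sum_def sum.distrib[symmetric] expand fam_def
    by (intro sum.cong prod.cong refl arg_cong2[where f = times]) auto
  also have "\<dots> = (\<Sum>X\<in>?P. c X * gowers_sum m K (fam X))"
    unfolding gowers_sum_def sum_distrib_left
    by (subst sum.swap[of _ ?P], subst sum.swap[of _ ?P]) simp
  also have "\<dots> \<le> (\<Sum>X\<in>?P. c X * B)"
  proof (intro sum_mono mult_left_mono)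
    fix X
    show "0 \<le> c X"
      by (cases "even (card (Pow K) - card X)") (auto simp: c_def)
    have "\<bar>gowers_sum m K (fam X)\<bar> \<le> B"
      using assms by (intro gowers_Cauchy_Schwarz) (auto simp: fam_def)
    then show "gowers_sum m K (fam X) \<le> B"
      by simp
  qed
  \<comment> \<open>The coefficients are summed by reading the expansion backwards with all factors
    equal to 1; the product of the differences vanishes.\<close>
  also have "\<dots> = ((\<Prod>T\<in>Pow K. 1 + 1) + (\<Prod>T\<in>Pow K. 1 - 1)) * B"
    unfolding expand by (simp add: sum_distrib_right)
  also have "\<dots> = 2 ^ 2 ^ card K * B"
    using assms by (simp add: card_Pow)
  finally show ?thesis .
qed

text \<open>Makes visible that the product is linear in the function at the vertex
  \<open>{}\<close>, which is evaluated at the base point alone.\<close>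

lemma gowers_sum_split_empty:
  assumes "finite K"
  shows "gowers_sum m K (\<lambda>T. if T = {} then u else v) =
    (\<Sum>x\<in>cube m. \<Sum>h\<in>K \<rightarrow>\<^sub>E cube m.
      u x * (\<Prod>T\<in>Pow K - {{}}. v (\<lambda>i. x i + (\<Sum>j\<in>T. h j i))))"
proof -
  have "(\<Prod>T\<in>Pow K. if T = {} then a T else b T) = a {} * (\<Prod>T\<in>Pow K - {{}}. b T)"
    for a b :: "nat set \<Rightarrow> real"
    using assms by (subst prod.remove[of _ "{}"]) (auto intro!: prod.cong)
  then show ?thesis
    unfolding gowers_sum_def by (intro sum.cong refl) (simp add: if_distribR)
qed

text \<open>By linearity at \<open>{}\<close> the left side is a single Gowers product with
  \<open>s * (u + v)\<close> at \<open>{}\<close> and \<open>v\<close> elsewhere, so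
  Gowers--Cauchy--Schwarz applies. The free scale \<open>s\<close> takes the place of dividing by a
  norm; it is chosen in \<open>Clarkson_squeeze\<close>.\<close>

lemma gowers_sum_pairing:
  assumes "finite K" "K \<noteq> {}"
  shows "s * (gowers_sum m K (\<lambda>T. if T = {} then u else v) + gowers_sum m K (\<lambda>_. v)) \<le>
    max (s ^ 2 ^ card K * gowers_sum m K (\<lambda>_ y. u y + v y)) (gowers_sum m K (\<lambda>_. v))"
proof -
  let ?B = "max (s ^ 2 ^ card K * gowers_sum m K (\<lambda>_ y. u y + v y)) (gowers_sum m K (\<lambda>_. v))"
  have "s * (gowers_sum m K (\<lambda>T. if T = {} then u else v) + gowers_sum m K (\<lambda>_. v)) =
      s * (gowers_sum m K (\<lambda>T. if T = {} then u else v) + gowers_sum m K (\<lambda>T. if T = {} then v else v))"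
    by simp
  also have "\<dots> = gowers_sum m K (\<lambda>T. if T = {} then (\<lambda>y. s * (u y + v y)) else v)"
    unfolding gowers_sum_split_empty[OF assms(1)] sum.distrib[symmetric] sum_distrib_left
    by (intro sum.cong refl) (simp add: algebra_simps)
  also have "\<dots> \<le> \<bar>\<dots>\<bar>"
    by simp
  also have "\<dots> \<le> ?B"
    using assms by (intro gowers_Cauchy_Schwarz) (auto simp: gowers_sum_scale)
  finally show ?thesis .
qed

section \<open>Parallelepipeds in a residue class of weights\<close>

text \<open>The transpose of the tuple \<open>h\<close>: choosing \<open>h\<close> amounts to
  choosing one subset of \<open>K\<close> independently for each coordinate. Sums over
  \<open>h\<close> therefore factorize over the coordinates.\<close>

definition direction_class :: "nat set \<Rightarrow> (nat \<Rightarrow> nat \<Rightarrow> bit) \<Rightarrow> nat \<Rightarrow> nat set" where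
  "direction_class K h i = {j \<in> K. h j i = 1}"

lemma direction_class_subset: "direction_class K h i \<subseteq> K"
  by (auto simp: direction_class_def)

lemma sum_bit_eq_one_iff:
  fixes b :: "'a \<Rightarrow> bit"
  assumes "finite T"
  shows "(\<Sum>j\<in>T. b j) = 1 \<longleftrightarrow> odd (card {j \<in> T. b j = 1})"
  using assms
proof (induction T rule: finite_induct)
  case (insert t T)
  have *: "{j \<in> insert t T. b j = 1} =
      (if b t = 1 then insert t {j \<in> T. b j = 1} else {j \<in> T. b j = 1})"
    by auto
  show ?case
    unfolding * using insert by (cases "b t") (auto simp: add_bit_eq_xor)
qed simp

lemma shift_eq_one_iff:
  assumes "finite K" "T \<subseteq> K"
  shows "x i + (\<Sum>j\<in>T. h j i) = (1 :: bit) \<longleftrightarrow> (x i = 1) \<noteq> odd (card (T \<inter> direction_class K h i))"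
proof -
  have "T \<inter> direction_class K h i = {j \<in> T. h j i = 1}"
    using assms by (auto simp: direction_class_def)
  moreover have "(\<Sum>j\<in>T. h j i) = 1 \<longleftrightarrow> odd (card {j \<in> T. h j i = 1})"
    using assms by (intro sum_bit_eq_one_iff) (auto dest: finite_subset)
  ultimately show ?thesis
    by (cases "x i"; cases "\<Sum>j\<in>T. h j i") (auto simp: add_bit_eq_xor)
qed

lemma sum_direction_class:
  fixes \<Phi> :: "(nat \<Rightarrow> nat set) \<Rightarrow> 'a :: comm_monoid_add"
  shows "(\<Sum>h\<in>K \<rightarrow>\<^sub>E cube m. \<Phi> (\<lambda>i\<in>{..<m}. direction_class K h i)) =
    (\<Sum>g\<in>{..<m} \<rightarrow>\<^sub>E Pow K. \<Phi> g)"
  by (rule sum.reindex_bij_witness[of _ "\<lambda>g. \<lambda>j\<in>K. \<lambda>i. of_bool (i < m \<and> j \<in> g i)"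
        "\<lambda>h. \<lambda>i\<in>{..<m}. direction_class K h i"])
    (auto simp: direction_class_def cube_def fun_eq_iff PiE_iff extensional_def restrict_def)

lemma sum_prod_direction_class:
  fixes \<phi> :: "nat \<Rightarrow> nat set \<Rightarrow> 'a :: comm_semiring_1"
  assumes "finite K"
  shows "(\<Sum>h\<in>K \<rightarrow>\<^sub>E cube m. \<Prod>i<m. \<phi> i (direction_class K h i)) = (\<Prod>i<m. \<Sum>S\<in>Pow K. \<phi> i S)"
proof -
  have "(\<Sum>h\<in>K \<rightarrow>\<^sub>E cube m. \<Prod>i<m. \<phi> i (direction_class K h i)) =
      (\<Sum>h\<in>K \<rightarrow>\<^sub>E cube m. \<Prod>i<m. \<phi> i ((\<lambda>i\<in>{..<m}. direction_class K h i) i))"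
    by (intro sum.cong prod.cong) auto
  also have "\<dots> = (\<Sum>g\<in>{..<m} \<rightarrow>\<^sub>E Pow K. \<Prod>i<m. \<phi> i (g i))"
    by (rule sum_direction_class)
  finally show ?thesis
    using assms by (simp add: prod_sum_PiE)
qed

lemma card_directions: "finite K \<Longrightarrow> card (K \<rightarrow>\<^sub>E cube m) = 2 ^ (m * card K)"
  by (simp add: card_PiE card_cube power_mult)

section \<open>Additive characters modulo \<open>M\<close>\<close>

definition unity_char :: "nat \<Rightarrow> int \<Rightarrow> complex" where
  "unity_char M t = cis (2 * pi * of_int t / of_nat M)"

lemma unity_char_add: "unity_char M (s + t) = unity_char M s * unity_char M t"
  by (simp add: unity_char_def cis_mult add_divide_distrib distrib_left)

lemma unity_char_0 [simp]: "unity_char M 0 = 1"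
  by (simp add: unity_char_def)

lemma norm_unity_char [simp]: "norm (unity_char M t) = 1"
  by (simp add: unity_char_def)

lemma unity_char_nonzero [simp]: "unity_char M t \<noteq> 0"
  using norm_unity_char[of M t] by (metis norm_zero zero_neq_one)

lemma unity_char_sum: "unity_char M (\<Sum>i\<in>A. f i) = (\<Prod>i\<in>A. unity_char M (f i))"
  by (induction A rule: infinite_finite_induct) (auto simp: unity_char_add)

lemma unity_char_power: "unity_char M (int r * t) = unity_char M t ^ r"
  by (induction r) (auto simp: unity_char_add algebra_simps)

lemma unity_char_eq_1_iff:
  assumes "M > 0"
  shows "unity_char M t = 1 \<longleftrightarrow> int M dvd t"
proof
  assume "unity_char M t = 1"
  then have "cos (2 * pi * of_int t / of_nat M) = 1"
    by (simp add: unity_char_def complex_eq_iff)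
  then obtain l :: int where "2 * pi * of_int t / of_nat M = of_int l * 2 * pi"
    unfolding cos_one_2pi_int by blast
  then have "real_of_int t = of_int (l * int M)"
    using assms by (simp add: field_simps)
  then show "int M dvd t"
    unfolding of_int_eq_iff by simp
next
  assume "int M dvd t"
  then obtain l where l: "t = int M * l" ..
  have "2 * pi * of_int t / of_nat M = 2 * pi * of_int l"
    using assms by (simp add: l field_simps)
  then show "unity_char M t = 1"
    by (simp add: unity_char_def complex_eq_iff)
qed

lemma unity_char_eq_iff:
  assumes "M > 0"
  shows "unity_char M s = unity_char M t \<longleftrightarrow> int M dvd s - t"
proof -
  have "unity_char M s = unity_char M (s - t) * unity_char M t"
    by (simp flip: unity_char_add)
  then show ?thesis
    using unity_char_eq_1_iff[OF assms, of "s - t"] by simp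
qed

lemma sum_unity_char:
  assumes "M > 0"
  shows "(\<Sum>r<M. unity_char M (int r * t)) = (if int M dvd t then of_nat M else 0)"
proof (cases "int M dvd t")
  case True
  then have "unity_char M (int r * t) = 1" for r
    by (simp add: unity_char_eq_1_iff[OF assms])
  then show ?thesis
    using True by simp
next
  case False
  have "unity_char M t ^ M = 1"
    using unity_char_eq_1_iff[OF assms] by (simp flip: unity_char_power)
  then show ?thesis
    using False unity_char_eq_1_iff[OF assms, of t] by (simp add: unity_char_power sum_gp_strict)
qed

section \<open>Strict bounds for sums of unit complex numbers\<close>

lemma abs_divide_diff:
  fixes a :: real
  assumes "a > 0"
  shows "\<bar>x / a - c\<bar> = \<bar>x - a * c\<bar> / a"
proof -
  have "x / a - c = (x - a * c) / a"
    using assms by (simp add: field_simps)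
  then show ?thesis
    using assms by (simp add: abs_divide)
qed

text \<open>By the parallelogram law the distance of \<open>a\<close> and \<open>b\<close> is
  exactly what their sum loses.\<close>

lemma norm_add_unit_less:
  fixes a b :: complex
  assumes "norm a = 1" "norm b = 1" "a \<noteq> b"
  shows "norm (a + b) < 2"
proof -
  have "(norm (a + b))\<^sup>2 + (norm (a - b))\<^sup>2 = 2 * (norm a)\<^sup>2 + 2 * (norm b)\<^sup>2"
    unfolding cmod_power2 by (simp add: power2_eq_square algebra_simps)
  also have "\<dots> = 4"
    using assms by simp
  finally have "(norm (a + b))\<^sup>2 + (norm (a - b))\<^sup>2 = 4" .
  moreover have "(norm (a - b))\<^sup>2 > 0"
    using assms by simp
  ultimately have "(norm (a + b))\<^sup>2 < 4"
    by linarith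
  then have "(norm (a + b))\<^sup>2 < 2\<^sup>2"
    by simp
  then show ?thesis
    by (rule power_less_imp_less_base) simp
qed

lemma norm_sum_unit_less:
  fixes f :: "'a \<Rightarrow> complex"
  assumes "finite X" "y \<in> X" "z \<in> X" "f y \<noteq> f z" "\<And>x. x \<in> X \<Longrightarrow> norm (f x) = 1"
  shows "norm (\<Sum>x\<in>X. f x) < card X"
proof -
  have yz: "y \<noteq> z"
    using assms by auto
  have "(\<Sum>x\<in>X. f x) = (f y + f z) + (\<Sum>x\<in>X - {y, z}. f x)"
    using assms(1-3) yz by (subst sum.subset_diff[of "{y, z}"]) auto
  also have "norm \<dots> \<le> norm (f y + f z) + norm (\<Sum>x\<in>X - {y, z}. f x)"
    by (rule norm_triangle_ineq)
  also have "norm (f y + f z) < 2"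
    using assms by (intro norm_add_unit_less) auto
  also have "norm (\<Sum>x\<in>X - {y, z}. f x) \<le> card (X - {y, z})"
    using sum_norm_bound[of "X - {y, z}" f 1] assms(5) by simp
  also have "card (X - {y, z}) = card X - 2"
    using assms yz by (subst card_Diff_subset) auto
  also have "2 + real (card X - 2) = card X"
    using card_mono[of X "{y, z}"] assms yz by (simp add: of_nat_diff)
  finally show ?thesis by simp
qed

text \<open>Turns finitely many strict bounds into one rate of exponential decay. The additional 0
  under the maximum makes the rate nonnegative and covers the empty set.\<close>

lemma finite_uniform_less_one:
  fixes f :: "'a \<Rightarrow> real"
  assumes "finite A" "\<And>x. x \<in> A \<Longrightarrow> f x < 1"
  obtains \<rho> where "0 \<le> \<rho>" "\<rho> < 1" "\<And>x. x \<in> A \<Longrightarrow> f x \<le> \<rho>"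
proof
  show "0 \<le> Max (insert 0 (f ` A))" "Max (insert 0 (f ` A)) < 1"
    "\<And>x. x \<in> A \<Longrightarrow> f x \<le> Max (insert 0 (f ` A))"
    using assms by auto
qed

section \<open>Completing a base point to a parallelepiped in a residue class\<close>

lemma hamming_weight_eq_sum: "int (hamming_weight m x) = (\<Sum>i<m. of_bool (x i = 1))"
proof -
  have "{..<m} \<inter> {i. x i = 1} = {i. i < m \<and> x i = 1}"
    by auto
  then show ?thesis
    by (simp add: hamming_weight_def sum.If_cases of_bool_def)
qed

text \<open>
  The relations modulo \<open>M\<close> between the weights of the vertices of a random parallelepiped.
  The coefficient at the vertex \<open>{}\<close> is omitted: it is minus the sum of the others.
\<close>

definition parity_relations :: "nat \<Rightarrow> nat set \<Rightarrow> (nat set \<Rightarrow> nat) set" where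
  "parity_relations M K = {r \<in> (Pow K - {{}}) \<rightarrow>\<^sub>E {..<M}.
     \<forall>S\<subseteq>K. int M dvd (\<Sum>T\<in>Pow K - {{}}. int (r T) * of_bool (odd (card (T \<inter> S))))}"

text \<open>No condition is imposed at the vertex \<open>{}\<close>: there an arbitrary function of
  the base point will stand instead of the residue class, see
  \<open>gowers_sum_residue_density\<close>.\<close>

definition mod_completions ::
    "nat \<Rightarrow> nat \<Rightarrow> nat set \<Rightarrow> nat \<Rightarrow> (nat \<Rightarrow> bit) \<Rightarrow> (nat \<Rightarrow> nat \<Rightarrow> bit) set" where
  "mod_completions m M K n x = {h \<in> K \<rightarrow>\<^sub>E cube m. \<forall>T\<in>Pow K - {{}}.
     int M dvd int (hamming_weight m (\<lambda>i. x i + (\<Sum>j\<in>T. h j i))) - int n}"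

text \<open>Each congruence is detected by a sum over characters. Multiplying out over the vertices
  gives a sum over coefficient families \<open>r\<close>; the exponents are additive over the
  coordinates, so the sum over the directions becomes a product.\<close>

lemma card_mod_completions_expand:
  fixes K :: "nat set" and M m n :: nat and x :: "nat \<Rightarrow> bit"
  assumes "finite K" "M > 0"
  defines "X \<equiv> Pow K - {{}}"
  shows "of_nat (M ^ card X * card (mod_completions m M K n x)) =
    (\<Sum>r\<in>X \<rightarrow>\<^sub>E {..<M}. unity_char M (- int n * (\<Sum>T\<in>X. int (r T))) *
       (\<Prod>i<m. \<Sum>S\<in>Pow K.
          unity_char M (\<Sum>T\<in>X. int (r T) * of_bool ((x i = 1) \<noteq> odd (card (T \<inter> S))))))"
proof -
  let ?e = "unity_char M"
  define W where "W = (\<lambda>h (T :: nat set). int (hamming_weight m (\<lambda>i. x i + (\<Sum>j\<in>T. h j i))))"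
  define c where "c = (\<lambda>r i S. \<Sum>T\<in>X. int (r T) * of_bool ((x i = 1) \<noteq> odd (card (T \<inter> S))))"
  have fin: "finite X"
    using assms by simp
  have finD: "finite (K \<rightarrow>\<^sub>E cube m)"
    using assms by (intro finite_PiE) (auto simp: finite_cube)
  have ind: "(\<Prod>T\<in>X. \<Sum>r<M. ?e (int r * (W h T - int n))) =
      of_nat (M ^ card X) * of_bool (\<forall>T\<in>X. int M dvd W h T - int n)" for h
    using fin by (auto simp: sum_unity_char[OF assms(2)])
  have "of_nat (M ^ card X * card (mod_completions m M K n x)) =
      (\<Sum>h\<in>K \<rightarrow>\<^sub>E cube m. \<Prod>T\<in>X. \<Sum>r<M. ?e (int r * (W h T - int n)))"
  proof -
    have "mod_completions m M K n x = (K \<rightarrow>\<^sub>E cube m) \<inter> {h. \<forall>T\<in>X. int M dvd W h T - int n}"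
      by (auto simp: mod_completions_def W_def X_def)
    then show ?thesis
      unfolding ind sum_distrib_left[symmetric] using finD
      by (simp add: of_bool_def sum.If_cases)
  qed
  also have "\<dots> = (\<Sum>h\<in>K \<rightarrow>\<^sub>E cube m. \<Sum>r\<in>X \<rightarrow>\<^sub>E {..<M}. \<Prod>T\<in>X. ?e (int (r T) * (W h T - int n)))"
    using fin by (simp add: prod_sum_PiE)
  also have "\<dots> = (\<Sum>r\<in>X \<rightarrow>\<^sub>E {..<M}. \<Sum>h\<in>K \<rightarrow>\<^sub>E cube m. \<Prod>T\<in>X. ?e (int (r T) * (W h T - int n)))"
    by (rule sum.swap)
  also have "\<dots> = (\<Sum>r\<in>X \<rightarrow>\<^sub>E {..<M}. ?e (- int n * (\<Sum>T\<in>X. int (r T))) *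
      (\<Prod>i<m. \<Sum>S\<in>Pow K. ?e (c r i S)))"
  proof (rule sum.cong[OF refl])
    fix r
    have "(\<Prod>T\<in>X. ?e (int (r T) * (W h T - int n))) =
        ?e (- int n * (\<Sum>T\<in>X. int (r T))) * (\<Prod>i<m. ?e (c r i (direction_class K h i)))" for h
    proof -
      have "W h T = (\<Sum>i<m. of_bool ((x i = 1) \<noteq> odd (card (T \<inter> direction_class K h i))))"
        if "T \<in> X" for T
        unfolding W_def hamming_weight_eq_sum using that assms
        by (intro sum.cong refl) (simp add: shift_eq_one_iff X_def)
      then have "(\<Sum>T\<in>X. int (r T) * W h T) =
          (\<Sum>T\<in>X. \<Sum>i<m. int (r T) * of_bool ((x i = 1) \<noteq> odd (card (T \<inter> direction_class K h i))))"
        unfolding sum_distrib_left[symmetric] by (intro sum.cong) auto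
      also have "\<dots> = (\<Sum>i<m. c r i (direction_class K h i))"
        unfolding c_def by (rule sum.swap)
      finally have *: "(\<Sum>T\<in>X. int (r T) * (W h T - int n)) =
          - int n * (\<Sum>T\<in>X. int (r T)) + (\<Sum>i<m. c r i (direction_class K h i))"
        by (simp add: right_diff_distrib sum_subtractf sum_distrib_left sum_negf mult.commute)
      show ?thesis
        unfolding unity_char_sum[symmetric] * unity_char_add ..
    qed
    then show "(\<Sum>h\<in>K \<rightarrow>\<^sub>E cube m. \<Prod>T\<in>X. ?e (int (r T) * (W h T - int n))) =
        ?e (- int n * (\<Sum>T\<in>X. int (r T))) * (\<Prod>i<m. \<Sum>S\<in>Pow K. ?e (c r i S))"
      by (simp only: sum_distrib_left[symmetric]
          sum_prod_direction_class[OF assms(1), of "\<lambda>i S. ?e (c r i S)"])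
  qed
  finally show ?thesis
    unfolding c_def .
qed

text \<open>A family \<open>r\<close> contributes a product over the coordinates of sums of
  \<open>2 ^ card K\<close> unit numbers. If \<open>r\<close> is a parity relation, the summands at
  each coordinate coincide, and the remaining phase is 1 because the weight of \<open>x\<close> is
  congruent to \<open>n\<close>. Otherwise two summands differ at every coordinate, and each
  coordinate loses a fixed factor.\<close>

lemma card_mod_completions_asymp:
  assumes "finite K" "M > 0"
  obtains \<rho> :: real where "0 \<le> \<rho>" "\<rho> < 1"
    "\<And>m n x. int M dvd int (hamming_weight m x) - int n \<Longrightarrow>
      \<bar>real (M ^ card (Pow K - {{}}) * card (mod_completions m M K n x)) / 2 ^ (m * card K)
        - card (parity_relations M K)\<bar> \<le> real M ^ card (Pow K - {{}}) * \<rho> ^ m"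
proof -
  let ?e = "unity_char M"
  define X where "X = Pow K - {{}}"
  define P :: real where "P = 2 ^ card K"
  have finX: "finite X" and P: "P > 0" "card (Pow K) = P"
    using assms by (auto simp: X_def P_def card_Pow)
  define \<Omega> where "\<Omega> = X \<rightarrow>\<^sub>E {..<M}"
  have fin\<Omega>: "finite \<Omega>" "card \<Omega> = M ^ card X"
    using finX by (auto simp: \<Omega>_def card_PiE intro: finite_PiE)
  define R where "R = parity_relations M K"
  have R: "R \<subseteq> \<Omega>" "finite R"
    using fin\<Omega> by (auto simp: R_def \<Omega>_def parity_relations_def X_def intro: finite_subset)
  define c where "c = (\<lambda>r b S. \<Sum>T\<in>X. int (r T) * of_bool (b \<noteq> odd (card (T \<inter> S))))"
  define A where "A = (\<lambda>r b. \<Sum>S\<in>Pow K. ?e (c r b S))"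
  have c_empty: "c r False {} = 0" "c r True {} = (\<Sum>T\<in>X. int (r T))" for r
    by (simp_all add: c_def)
  \<comment> \<open>Where \<open>x i = 1\<close> all parities are complemented, which reflects the
    exponent. Both values of the bit thus lead to the same condition on \<open>r\<close>.\<close>
  have c_True: "c r True S = (\<Sum>T\<in>X. int (r T)) - c r False S" for r S
    unfolding c_def sum_subtractf[symmetric] by (intro sum.cong) auto
  have less: "norm (A r b) / P < 1" if r: "(r, b) \<in> (\<Omega> - R) \<times> UNIV" for r b
  proof -
    have "r \<in> \<Omega>" "r \<notin> R"
      using r by auto
    then obtain S where S: "S \<subseteq> K" "\<not> int M dvd c r False S"
      by (auto simp: R_def \<Omega>_def parity_relations_def X_def c_def)
    have "?e (c r b S) \<noteq> ?e (c r b {})"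
      using S(2) by (cases b) (auto simp: unity_char_eq_iff[OF assms(2)] unity_char_eq_1_iff[OF assms(2)] c_empty c_True)
    then have "norm (A r b) < card (Pow K)"
      unfolding A_def using S(1) assms by (intro norm_sum_unit_less) auto
    then show ?thesis
      using P by simp
  qed
  obtain \<rho> where \<rho>: "0 \<le> \<rho>" "\<rho> < 1" "\<And>rb. rb \<in> (\<Omega> - R) \<times> UNIV \<Longrightarrow> norm (A (fst rb) (snd rb)) / P \<le> \<rho>"
    by (rule finite_uniform_less_one[of "(\<Omega> - R) \<times> UNIV" "\<lambda>rb. norm (A (fst rb) (snd rb)) / P"])
      (use fin\<Omega> less in \<open>auto simp: case_prod_unfold\<close>)
  have \<rho>_le: "norm (A r b) \<le> \<rho> * P" if "r \<in> \<Omega> - R" for r b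
    using \<rho>(3)[of "(r, b)"] that P by (simp add: field_simps)
  show ?thesis
  proof (rule that[OF \<rho>(1,2)])
    fix m n x
    assume dvd: "int M dvd int (hamming_weight m x) - int n"
    define F where "F = (\<lambda>r. ?e (- int n * (\<Sum>T\<in>X. int (r T))) * (\<Prod>i<m. A r (x i = 1)))"
    have expand: "of_nat (M ^ card X * card (mod_completions m M K n x)) = (\<Sum>r\<in>\<Omega>. F r)"
      using card_mod_completions_expand[OF assms, of m n x]
      unfolding F_def A_def c_def \<Omega>_def X_def .
    have F_R: "F r = of_real (P ^ m)" if "r \<in> R" for r
    proof -
      define s where "s = (\<Sum>T\<in>X. int (r T))"
      have c0: "int M dvd c r False S" if "S \<subseteq> K" for S
        using \<open>r \<in> R\<close> that by (auto simp: R_def parity_relations_def X_def c_def)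
      have e0: "?e (c r b S) = ?e (of_bool b * s)" if "S \<subseteq> K" for b S
        using c0[OF that] by (cases b) (auto simp: unity_char_eq_iff[OF assms(2)] unity_char_eq_1_iff[OF assms(2)] c_True s_def)
      have "A r b = of_real P * ?e (of_bool b * s)" for b
        unfolding A_def using P(2) by (simp add: e0) (metis of_real_of_nat_eq)
      then have "(\<Prod>i<m. A r (x i = 1)) = of_real (P ^ m) * ?e (\<Sum>i<m. of_bool (x i = 1) * s)"
        unfolding unity_char_sum by (simp add: prod.distrib)
      also have "(\<Sum>i<m. of_bool (x i = 1) * s) = int (hamming_weight m x) * s"
        by (simp add: hamming_weight_eq_sum sum_distrib_right)
      finally have "F r = of_real (P ^ m) * ?e (- int n * s + int (hamming_weight m x) * s)"
        unfolding F_def s_def[symmetric] by (simp only: unity_char_add mult.left_commute)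
      also have "- int n * s + int (hamming_weight m x) * s = (int (hamming_weight m x) - int n) * s"
        by (simp add: algebra_simps)
      also have "?e \<dots> = 1"
        using dvd by (simp add: unity_char_eq_1_iff[OF assms(2)])
      finally show ?thesis by simp
    qed
    have F_not_R: "norm (F r) \<le> (\<rho> * P) ^ m" if "r \<in> \<Omega> - R" for r
    proof -
      have "norm (F r) = (\<Prod>i<m. norm (A r (x i = 1)))"
        by (simp add: F_def norm_mult prod_norm)
      also have "\<dots> \<le> (\<Prod>i<m. \<rho> * P)"
        using \<rho>_le[OF that] by (intro prod_mono) auto
      finally show ?thesis by simp
    qed
    have "of_nat (M ^ card X * card (mod_completions m M K n x)) =
        (\<Sum>r\<in>\<Omega> - R. F r) + of_real (P ^ m) * of_nat (card R)"
      unfolding expand using R fin\<Omega> by (simp add: sum.subset_diff[of R \<Omega>] F_R)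
    then have "complex_of_real (real (M ^ card X * card (mod_completions m M K n x)) - P ^ m * card R) =
        (\<Sum>r\<in>\<Omega> - R. F r)"
      by (simp add: algebra_simps)
    moreover have "norm (\<Sum>r\<in>\<Omega> - R. F r) \<le> real M ^ card X * (\<rho> * P) ^ m"
    proof -
      have "norm (\<Sum>r\<in>\<Omega> - R. F r) \<le> card (\<Omega> - R) * (\<rho> * P) ^ m"
        using F_not_R by (rule sum_norm_bound)
      also have "\<dots> \<le> card \<Omega> * (\<rho> * P) ^ m"
        using card_mono[OF fin\<Omega>(1), of "\<Omega> - R"] P(1) \<rho>(1) by (intro mult_right_mono) auto
      finally show ?thesis
        by (simp add: fin\<Omega>)
    qed
    ultimately have "\<bar>real (M ^ card X * card (mod_completions m M K n x)) - P ^ m * card R\<bar> \<le>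
        real M ^ card X * (\<rho> * P) ^ m"
      by (metis norm_of_real)
    then have "\<bar>real (M ^ card X * card (mod_completions m M K n x)) - P ^ m * card R\<bar> / P ^ m \<le>
        real M ^ card X * \<rho> ^ m"
      using P by (simp add: power_mult_distrib divide_le_eq mult.assoc)
    moreover have "P ^ m = 2 ^ (m * card K)"
      by (simp add: P_def mult.commute flip: power_mult)
    ultimately show "\<bar>real (M ^ card (Pow K - {{}}) * card (mod_completions m M K n x)) / 2 ^ (m * card K)
        - card (parity_relations M K)\<bar> \<le> real M ^ card (Pow K - {{}}) * \<rho> ^ m"
      using P(1) by (simp add: X_def R_def abs_divide_diff)
  qed
qed

section \<open>Counting the relations between weights\<close>

text \<open>Expand the power of -2 + 1 with exponent \<open>card A\<close> over the subsets of
  \<open>A\<close>. It equals 1 or -1 according to parity; subtracting the term of the empty set and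
  dividing by -2 leaves the exponents \<open>card J - 1\<close>.\<close>

lemma odd_card_eq_sum_subsets:
  assumes "finite A"
  shows "int (of_bool (odd (card A))) = (\<Sum>J\<in>Pow A - {{}}. (- 2) ^ (card J - 1))"
proof -
  have "(\<Prod>j\<in>A. (- 2) + (1 :: int)) = (\<Sum>J\<in>Pow A. (\<Prod>j\<in>J. - 2) * (\<Prod>j\<in>A - J. 1))"
    by (rule prod_add[OF assms])
  then have "(- 1) ^ card A = (\<Sum>J\<in>Pow A. (- 2 :: int) ^ card J)"
    by simp
  also have "\<dots> = 1 + (\<Sum>J\<in>Pow A - {{}}. (- 2) ^ card J)"
    using assms by (subst sum.remove[of _ "{}"]) auto
  also have "(\<Sum>J\<in>Pow A - {{}}. (- 2 :: int) ^ card J) =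
      (\<Sum>J\<in>Pow A - {{}}. - 2 * (- 2) ^ (card J - 1))"
  proof (rule sum.cong[OF refl])
    fix J assume "J \<in> Pow A - {{}}"
    then have "card J > 0"
      using assms by (auto simp: card_gt_0_iff dest: finite_subset)
    then show "(- 2 :: int) ^ card J = - 2 * (- 2) ^ (card J - 1)"
      by (metis power_minus_mult mult.commute)
  qed
  finally have "(- 1) ^ card A = 1 - 2 * (\<Sum>J\<in>Pow A - {{}}. (- 2 :: int) ^ (card J - 1))"
    by (simp add: sum_distrib_left sum_negf)
  then show ?thesis
    by (cases "odd (card A)") auto
qed

text \<open>The parity of \<open>T \<inter> S\<close> is expanded over its subsets \<open>J\<close>,
  and the sums are exchanged. The gain is a power of 2 in front of the sums belonging to large
  \<open>J\<close>, which weakens what must be required of them modulo \<open>M\<close>.\<close>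

lemma sum_parity_eq:
  fixes a :: "nat set \<Rightarrow> int"
  assumes "finite K" "S \<subseteq> K"
  shows "(\<Sum>T\<in>Pow K - {{}}. a T * of_bool (odd (card (T \<inter> S)))) =
    (\<Sum>J\<in>Pow S - {{}}. (- 2) ^ (card J - 1) * (\<Sum>T | T \<subseteq> K \<and> J \<subseteq> T. a T))"
proof -
  have fin: "finite S"
    using assms by (auto dest: finite_subset)
  have "(\<Sum>T\<in>Pow K - {{}}. a T * of_bool (odd (card (T \<inter> S)))) =
      (\<Sum>T\<in>Pow K - {{}}. \<Sum>J\<in>Pow S - {{}}. if J \<subseteq> T then (- 2) ^ (card J - 1) * a T else 0)"
  proof (rule sum.cong[OF refl])
    fix T
    have "a T * of_bool (odd (card (T \<inter> S))) = a T * (\<Sum>J\<in>Pow (T \<inter> S) - {{}}. (- 2) ^ (card J - 1))"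
      using odd_card_eq_sum_subsets[of "T \<inter> S"] fin by simp
    also have "\<dots> = (\<Sum>J\<in>Pow (T \<inter> S) - {{}}. (- 2) ^ (card J - 1) * a T)"
      by (simp add: sum_distrib_left mult.commute)
    also have "\<dots> = (\<Sum>J\<in>Pow S - {{}}. if J \<subseteq> T then (- 2) ^ (card J - 1) * a T else 0)"
      using fin by (intro sum.mono_neutral_cong_left) auto
    finally show "a T * of_bool (odd (card (T \<inter> S))) = \<dots>" .
  qed
  also have "\<dots> = (\<Sum>J\<in>Pow S - {{}}. \<Sum>T\<in>Pow K - {{}}. if J \<subseteq> T then (- 2) ^ (card J - 1) * a T else 0)"
    by (rule sum.swap)
  also have "\<dots> = (\<Sum>J\<in>Pow S - {{}}. \<Sum>T | T \<subseteq> K \<and> J \<subseteq> T. (- 2) ^ (card J - 1) * a T)"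
    using assms by (intro sum.cong refl sum.mono_neutral_cong_right) auto
  finally show ?thesis
    by (simp add: sum_distrib_left)
qed

text \<open>
  By the previous lemma a family \<open>r\<close> is a parity relation as soon as, for every nonempty
  \<open>J\<close>, its sum over the supersets of \<open>J\<close> is divisible by \<open>2 ^ (card K - card J)\<close>. Pigeonhole
  yields many families with the same residues, and differences of these are relations.
\<close>

lemma card_parity_relations_pigeonhole:
  fixes K :: "nat set"
  assumes "finite K" "K \<noteq> {}"
  defines "X \<equiv> Pow K - {{}}" and "M \<equiv> 2 ^ (card K - 1)"
  shows "M ^ card X \<le> card (parity_relations M K) * (\<Prod>J\<in>X. 2 ^ (card K - card J))"
proof -
  define q where "q = (\<lambda>J :: nat set. 2 ^ (card K - card J) :: nat)"
  define f where "f = (\<lambda>r :: nat set \<Rightarrow> nat. \<lambda>J\<in>X. (\<Sum>T | T \<subseteq> K \<and> J \<subseteq> T. r T) mod q J)"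
  define \<Omega> where "\<Omega> = X \<rightarrow>\<^sub>E {..<M}"
  define B where "B = (\<Pi>\<^sub>E J\<in>X. {..<q J})"
  have finX: "finite X"
    using assms by (simp add: X_def)
  have fin: "finite \<Omega>" "finite B"
    using finX by (auto simp: \<Omega>_def B_def intro: finite_PiE)
  have M: "M > 0"
    by (simp add: M_def)
  have "f \<in> \<Omega> \<rightarrow> B"
    by (auto simp: f_def B_def q_def)
  moreover have "B \<noteq> {}"
    by (auto simp: B_def PiE_eq_empty_iff q_def lessThan_empty_iff)
  ultimately obtain y where y: "y \<in> B" "card \<Omega> \<le> card (f -` {y} \<inter> \<Omega>) * card B"
    using pigeonhole_card[OF _ fin] by blast
  have "\<Omega> \<noteq> {}"
    using M by (auto simp: \<Omega>_def PiE_eq_empty_iff lessThan_empty_iff)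
  then have "card \<Omega> > 0"
    using fin by (simp add: card_gt_0_iff)
  then have "f -` {y} \<inter> \<Omega> \<noteq> {}"
    using y(2) by auto
  then obtain r0 where r0: "r0 \<in> \<Omega>" "f r0 = y"
    by auto
  \<comment> \<open>Differences from a fixed member of the fibre, reduced into the range
    \<open>{..<M}\<close>. Reduction keeps them distinct because all values lie below
    \<open>M\<close>.\<close>
  define \<tau> where "\<tau> = (\<lambda>r :: nat set \<Rightarrow> nat. \<lambda>T\<in>X. nat ((int (r T) - int (r0 T)) mod int M))"
  have \<tau>: "int (\<tau> r T) = (int (r T) - int (r0 T)) mod int M" if "T \<in> X" for r T
    using that M by (simp add: \<tau>_def)
  have "inj_on \<tau> \<Omega>"
  proof (rule inj_onI)
    fix r s assume rs: "r \<in> \<Omega>" "s \<in> \<Omega>" "\<tau> r = \<tau> s"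
    show "r = s"
    proof (rule PiE_ext)
      show "r \<in> X \<rightarrow>\<^sub>E {..<M}" "s \<in> X \<rightarrow>\<^sub>E {..<M}"
        using rs by (auto simp: \<Omega>_def)
      fix T assume T: "T \<in> X"
      have "(int (r T) - int (r0 T)) mod int M = (int (s T) - int (r0 T)) mod int M"
        using \<tau>[OF T, of r] \<tau>[OF T, of s] rs(3) by simp
      then have "int M dvd (int (r T) - int (r0 T)) - (int (s T) - int (r0 T))"
        by (simp add: mod_eq_dvd_iff)
      then have "int (r T) mod int M = int (s T) mod int M"
        by (simp add: mod_eq_dvd_iff)
      moreover have "r T < M" "s T < M"
        using rs T by (auto simp: \<Omega>_def PiE_iff)
      ultimately show "r T = s T"
        by simp
    qed
  qed
  moreover have "\<tau> ` (f -` {y} \<inter> \<Omega>) \<subseteq> parity_relations M K"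
  proof (rule image_subsetI)
    fix r assume "r \<in> f -` {y} \<inter> \<Omega>"
    then have r: "r \<in> \<Omega>" "f r = f r0"
      using r0 by auto
    have "\<tau> r \<in> X \<rightarrow>\<^sub>E {..<M}"
      using M by (auto simp: \<tau>_def nat_less_iff)
    moreover have "int M dvd (\<Sum>T\<in>X. int (\<tau> r T) * of_bool (odd (card (T \<inter> S))))" if S: "S \<subseteq> K" for S
    proof -
      have "int M dvd (\<Sum>T\<in>X. (int (r T) - int (r0 T)) * of_bool (odd (card (T \<inter> S))))"
        unfolding X_def sum_parity_eq[OF assms(1) S]
      proof (rule dvd_sum)
        fix J assume J: "J \<in> Pow S - {{}}"
        then have JX: "J \<in> X" "finite J"
          using S assms by (auto simp: X_def dest: finite_subset)
        have "(\<Sum>T | T \<subseteq> K \<and> J \<subseteq> T. r T) mod q J = (\<Sum>T | T \<subseteq> K \<and> J \<subseteq> T. r0 T) mod q J"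
          using fun_cong[OF r(2), of J] JX by (simp add: f_def)
        then have "int (\<Sum>T | T \<subseteq> K \<and> J \<subseteq> T. r T) mod int (q J) =
            int (\<Sum>T | T \<subseteq> K \<and> J \<subseteq> T. r0 T) mod int (q J)"
          by (simp only: zmod_int[symmetric])
        then have "int (q J) dvd (\<Sum>T | T \<subseteq> K \<and> J \<subseteq> T. int (r T) - int (r0 T))"
          by (simp add: mod_eq_dvd_iff sum_subtractf)
        \<comment> \<open>The power of 2 from the parity expansion completes the modulus
          \<open>q J\<close> to \<open>M\<close>: the exponents \<open>card J - 1\<close> and
          \<open>card K - card J\<close> add up to \<open>card K - 1\<close>.\<close>
        then have "2 ^ (card J - 1) * int (q J) dvd
            (- 2) ^ (card J - 1) * (\<Sum>T | T \<subseteq> K \<and> J \<subseteq> T. int (r T) - int (r0 T))"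
          by (intro mult_dvd_mono) (auto simp: power_minus[of 2] dvd_mult)
        moreover have "2 ^ (card J - 1) * int (q J) = int M"
        proof -
          have "0 < card J" "card J \<le> card K"
            using J JX assms by (auto simp: card_gt_0_iff X_def intro: card_mono)
          then show ?thesis
            by (simp add: q_def M_def flip: power_add)
        qed
        ultimately show "int M dvd (- 2) ^ (card J - 1) * (\<Sum>T | T \<subseteq> K \<and> J \<subseteq> T. int (r T) - int (r0 T))"
          by simp
      qed
      moreover have "int M dvd (\<Sum>T\<in>X. int (\<tau> r T) * of_bool (odd (card (T \<inter> S)))) -
          (\<Sum>T\<in>X. (int (r T) - int (r0 T)) * of_bool (odd (card (T \<inter> S))))"
        unfolding sum_subtractf[symmetric] left_diff_distrib[symmetric]
        by (intro dvd_sum dvd_mult2) (simp add: \<tau> flip: mod_eq_dvd_iff)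
      ultimately show ?thesis
        by (simp add: dvd_diff_right_iff dvd_diff_left_iff)
    qed
    ultimately show "\<tau> r \<in> parity_relations M K"
      by (simp add: parity_relations_def X_def)
  qed
  moreover have "finite (parity_relations M K)"
    using fin(1) by (rule finite_subset[rotated]) (auto simp: parity_relations_def \<Omega>_def X_def)
  ultimately have "card (f -` {y} \<inter> \<Omega>) \<le> card (parity_relations M K)"
    by (metis card_inj_on_le inj_on_subset Int_lower2)
  then have "card \<Omega> \<le> card (parity_relations M K) * card B"
    using y(2) by (meson le_trans mult_le_mono1)
  then show ?thesis
    using finX by (simp add: \<Omega>_def B_def card_PiE q_def)
qed

lemma sum_card_Pow: "finite K \<Longrightarrow> 2 * (\<Sum>J\<in>Pow K. card J) = card K * 2 ^ card K"
proof (induction K rule: finite_induct)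
  case (insert x K)
  have "card (insert x J) = card J + 1" if "J \<in> Pow K" for J
    using that insert by (subst card_insert_disjoint) (auto dest: finite_subset)
  moreover have "inj_on (insert x) (Pow K)"
    using insert.hyps(2) by (intro inj_onI) (metis PowD insert_ident subsetD)
  ultimately have "(\<Sum>J\<in>insert x ` Pow K. card J) = (\<Sum>J\<in>Pow K. card J + 1)"
    by (simp add: sum.reindex)
  then have "(\<Sum>J\<in>Pow (insert x K). card J) = 2 * (\<Sum>J\<in>Pow K. card J) + 2 ^ card K"
    using insert unfolding Pow_insert by (subst sum.union_disjoint) (auto simp: sum_Suc card_Pow)
  then show ?case
    using insert by (simp add: algebra_simps)
qed simp

text \<open>The exponents of the pigeonhole bound are evaluated with the mean size of a subset,
  which is half of \<open>card K\<close>. Divided by \<open>2 ^ 2 ^ card K\<close>, the left side is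
  the constant arising for the middle slice in \<open>gowers_middle_density_bound\<close>.\<close>

lemma card_parity_relations_ge:
  assumes "finite K" "K \<noteq> {}"
  shows "2 * 2 ^ (card K * 2 ^ (card K - 1)) \<le>
    card (parity_relations (2 ^ (card K - 1)) K) * 2 ^ 2 ^ card K"
proof -
  define X where "X = Pow K - {{}}"
  define c where "c = card (parity_relations (2 ^ (card K - 1)) K)"
  define s where "s = (\<Sum>J\<in>X. card J)"
  define t where "t = (\<Sum>J\<in>X. card K - card J)"
  have K: "card K > 0"
    using assms by (simp add: card_gt_0_iff)
  have cX: "card X + 1 = 2 ^ card K"
    using assms by (simp add: X_def card_Diff_subset card_Pow)
  have s: "s = card K * 2 ^ (card K - 1)"
  proof -
    have "s = (\<Sum>J\<in>Pow K. card J)"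
      using assms by (simp add: s_def X_def sum.remove[of "Pow K" "{}" card])
    then have "2 * s = card K * (2 * 2 ^ (card K - 1))"
      using sum_card_Pow[OF assms(1)] K by (simp flip: power_Suc)
    then show ?thesis by simp
  qed
  have st: "s + t = card K * card X"
  proof -
    have "s + t = (\<Sum>J\<in>X. card K)"
      unfolding s_def t_def sum.distrib[symmetric] using assms
      by (intro sum.cong) (auto simp: X_def card_mono)
    then show ?thesis by simp
  qed
  have "2 ^ ((card K - 1) * card X) \<le> c * 2 ^ t"
    using card_parity_relations_pigeonhole[OF assms]
    by (simp add: c_def X_def t_def power_sum power_mult)
  then have "2 ^ ((card K - 1) * card X) * 2 ^ (card X + 1) \<le> c * 2 ^ t * 2 ^ (card X + 1)"
    by (rule mult_right_mono) simp
  moreover have "(card K - 1) * card X + (card X + 1) = s + t + 1"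
    using K by (cases "card K") (auto simp: st)
  ultimately have "2 ^ t * (2 * 2 ^ s) \<le> 2 ^ t * (c * 2 ^ (card X + 1))"
    by (simp add: algebra_simps flip: power_add)
  then show ?thesis
    unfolding s[symmetric] c_def[symmetric] cX[symmetric] by simp
qed

section \<open>The density of a residue class of weights\<close>

text \<open>Frequency 0 yields the main term. A frequency \<open>r \<noteq> 0\<close> contributes
  the \<open>m\<close>-th power of a sum of two different unit numbers, up to a phase, and is
  exponentially smaller.\<close>

lemma mod_slice_density_asymp:
  assumes "M > 0"
  obtains \<rho> :: real where "0 \<le> \<rho>" "\<rho> < 1"
    "\<And>m n. \<bar>real (M * card {x \<in> cube m. int M dvd int (hamming_weight m x) - int n}) / 2 ^ m - 1\<bar>
      \<le> M * \<rho> ^ m"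
proof -
  let ?e = "unity_char M"
  have "norm ((1 + ?e (int r)) / 2) < 1" if "r \<in> {..<M} - {0}" for r
  proof -
    have "\<not> int M dvd int r"
      using that by (auto dest: zdvd_imp_le)
    then have "norm (1 + ?e (int r)) < 2"
      using unity_char_eq_1_iff[OF assms] by (intro norm_add_unit_less) (auto dest: sym)
    then show ?thesis
      by (simp add: norm_divide)
  qed
  then obtain \<rho> where \<rho>: "0 \<le> \<rho>" "\<rho> < 1" "\<And>r. r \<in> {..<M} - {0} \<Longrightarrow> norm ((1 + ?e (int r)) / 2) \<le> \<rho>"
    by (rule finite_uniform_less_one[of "{..<M} - {0}" "\<lambda>r. norm ((1 + ?e (int r)) / 2)", rotated]) auto
  show ?thesis
  proof (rule that[OF \<rho>(1,2)])
    fix m n :: nat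
    define D where "D = {x \<in> cube m. int M dvd int (hamming_weight m x) - int n}"
    define F where "F = (\<lambda>r. ?e (- int n * int r) * (1 + ?e (int r)) ^ m)"
    have "complex_of_nat (M * card D) =
        (\<Sum>x\<in>cube m. \<Sum>r<M. ?e (int r * (int (hamming_weight m x) - int n)))"
    proof -
      have "D = cube m \<inter> {x. int M dvd int (hamming_weight m x) - int n}"
        by (auto simp: D_def)
      then show ?thesis
        by (simp add: sum_unity_char[OF assms] sum.If_cases finite_cube)
    qed
    also have "\<dots> = (\<Sum>r<M. \<Sum>x\<in>cube m. ?e (int r * (int (hamming_weight m x) - int n)))"
      by (rule sum.swap)
    also have "\<dots> = (\<Sum>r<M. F r)"
    proof (rule sum.cong[OF refl])
      fix r
      define \<phi> where "\<phi> = (\<lambda>(i :: nat) S. ?e (int r * of_bool (S \<noteq> ({} :: nat set))))"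
      \<comment> \<open>A point of the cube is read as a tuple of directions indexed by
        \<open>{0}\<close>, so that the factorization over the coordinates can be reused.\<close>
      have "(\<Sum>x\<in>cube m. \<Prod>i<m. \<phi> i (if x i = 1 then {0} else {})) =
          (\<Sum>h\<in>{0} \<rightarrow>\<^sub>E cube m. \<Prod>i<m. \<phi> i (direction_class {0} h i))"
        by (rule sum.reindex_bij_witness[of _ "\<lambda>h. h 0" "\<lambda>x. \<lambda>j\<in>{0}. x"])
          (auto simp: direction_class_def PiE_iff extensional_def fun_eq_iff
            intro!: prod.cong arg_cong2[where f = \<phi>] split: if_splits)
      also have "\<dots> = (\<Prod>i<m. \<Sum>S\<in>Pow {0}. \<phi> i S)"
        by (rule sum_prod_direction_class) simp
      also have "\<dots> = (1 + ?e (int r)) ^ m"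
        by (simp add: \<phi>_def Pow_insert add.commute)
      finally have *: "(\<Sum>x\<in>cube m. \<Prod>i<m. \<phi> i (if x i = 1 then {0} else {})) = (1 + ?e (int r)) ^ m" .
      have "?e (int r * (int (hamming_weight m x) - int n)) =
          ?e (- int n * int r) * (\<Prod>i<m. \<phi> i (if x i = 1 then {0} else {}))" for x
      proof -
        have "int r * (int (hamming_weight m x) - int n) =
            - int n * int r + (\<Sum>i<m. int r * of_bool (x i = 1))"
          unfolding hamming_weight_eq_sum sum_distrib_left[symmetric] by (simp add: algebra_simps)
        then show ?thesis
          unfolding \<phi>_def by (simp only: unity_char_add unity_char_sum) (auto intro!: prod.cong)
      qed
      then show "(\<Sum>x\<in>cube m. ?e (int r * (int (hamming_weight m x) - int n))) = F r"
        by (simp only: sum_distrib_left[symmetric] * F_def)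
    qed
    also have "\<dots> = 2 ^ m + (\<Sum>r\<in>{..<M} - {0}. F r)"
      using assms by (subst sum.remove[of _ 0]) (auto simp: F_def)
    finally have "complex_of_real (real (M * card D) - 2 ^ m) = (\<Sum>r\<in>{..<M} - {0}. F r)"
      by (simp add: algebra_simps)
    moreover have "norm (\<Sum>r\<in>{..<M} - {0}. F r) \<le> card ({..<M} - {0}) * (2 * \<rho>) ^ m"
    proof (rule sum_norm_bound)
      fix r assume "r \<in> {..<M} - {0}"
      then have "norm (1 + ?e (int r)) \<le> 2 * \<rho>"
        using \<rho>(3)[of r] by (simp add: norm_divide)
      then show "norm (F r) \<le> (2 * \<rho>) ^ m"
        using power_mono[of "norm (1 + ?e (int r))" "2 * \<rho>" m] by (simp add: F_def norm_mult norm_power)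
    qed
    moreover have "card ({..<M} - {0}) * (2 * \<rho>) ^ m \<le> M * (2 * \<rho>) ^ m"
      using \<rho>(1) card_mono[of "{..<M}" "{..<M} - {0}"] by (intro mult_right_mono) auto
    ultimately have "\<bar>real (M * card D) - 2 ^ m\<bar> \<le> M * (2 * \<rho>) ^ m"
      unfolding norm_of_real[where 'a = complex, symmetric] by (metis order_trans)
    then have "\<bar>real (M * card D) - 2 ^ m\<bar> / 2 ^ m \<le> M * \<rho> ^ m"
      by (simp add: power_mult_distrib divide_le_eq mult_ac)
    then show "\<bar>real (M * card {x \<in> cube m. int M dvd int (hamming_weight m x) - int n}) / 2 ^ m - 1\<bar>
        \<le> M * \<rho> ^ m"
      by (simp add: D_def abs_divide_diff)
  qed
qed

section \<open>Parallelepipeds in the middle slice\<close>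

lemma minus_one_power_card_Int:
  assumes "finite T"
  shows "(- 1 :: int) ^ card (T \<inter> S) = (\<Prod>j\<in>T. if j \<in> S then - 1 else 1)"
  using assms by (simp add: prod.If_cases)

text \<open>Orthogonality of Walsh characters: the sum factorizes over \<open>K\<close>, and an
  element of exactly one of the sets \<open>S\<close> and \<open>S'\<close> contributes the factor
  0.\<close>

lemma sum_minus_one_power_card_Int:
  assumes "finite K" "S \<subseteq> K" "S' \<subseteq> K"
  shows "(\<Sum>T\<in>Pow K. (- 1 :: int) ^ card (T \<inter> S) * (- 1) ^ card (T \<inter> S')) =
    (if S = S' then 2 ^ card K else 0)"
proof -
  define a where "a = (\<lambda>j. (if j \<in> S then - 1 else 1) * (if j \<in> S' then - 1 else 1) :: int)"
  have "(\<Sum>T\<in>Pow K. (- 1 :: int) ^ card (T \<inter> S) * (- 1) ^ card (T \<inter> S')) =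
      (\<Sum>T\<in>Pow K. (\<Prod>j\<in>T. a j) * (\<Prod>j\<in>K - T. 1))"
    using assms(1) by (intro sum.cong refl)
      (auto simp: a_def minus_one_power_card_Int prod.distrib[symmetric] dest: finite_subset)
  also have "\<dots> = (\<Prod>j\<in>K. a j + 1)"
    by (rule prod_add[OF assms(1), symmetric])
  also have "\<dots> = (if S = S' then 2 ^ card K else 0)"
  proof (cases "S = S'")
    case True
    then have "a j = 1" for j
      by (simp add: a_def)
    then show ?thesis
      using True by simp
  next
    case False
    then obtain j where "j \<in> S \<longleftrightarrow> j \<notin> S'"
      by blast
    then have "j \<in> K" "a j + 1 = 0"
      using assms by (auto simp: a_def)
    then show ?thesis
      using False assms(1) by (auto simp: prod_zero)
  qed
  finally show ?thesis .
qed

definition class_size :: "nat \<Rightarrow> nat set \<Rightarrow> (nat \<Rightarrow> nat \<Rightarrow> bit) \<Rightarrow> nat set \<Rightarrow> nat" where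
  "class_size m K h S = card {i \<in> {..<m}. direction_class K h i = S}"

lemma sum_class_size: "finite K \<Longrightarrow> (\<Sum>S\<in>Pow K. class_size m K h S) = m"
  using sum.group[of "{..<m}" "Pow K" "direction_class K h" "\<lambda>_. 1 :: nat"] direction_class_subset[of K h]
  by (simp add: class_size_def image_subset_iff)

lemma prod_power_class_size:
  fixes a :: "nat set \<Rightarrow> 'a :: comm_monoid_mult"
  assumes "finite K"
  shows "(\<Prod>S\<in>Pow K. a S ^ class_size m K h S) = (\<Prod>i<m. a (direction_class K h i))"
proof -
  have "(\<Prod>S\<in>Pow K. a S ^ class_size m K h S) =
      (\<Prod>S\<in>Pow K. \<Prod>i | i \<in> {..<m} \<and> direction_class K h i = S. a (direction_class K h i))"
    by (intro prod.cong refl) (simp add: class_size_def)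
  also have "\<dots> = (\<Prod>i<m. a (direction_class K h i))"
    using assms direction_class_subset[of K h] by (intro prod.group) auto
  finally show ?thesis .
qed

text \<open>Let each coordinate carry the sign given by its bit in \<open>x\<close>. Balance at the
  vertex \<open>T\<close> says that the Walsh transform of the signed class sums vanishes at
  \<open>T\<close>. As this holds for all \<open>T\<close>, inversion makes the signed sum of every
  class vanish.\<close>

lemma class_balanced:
  assumes "finite K" "S \<subseteq> K"
    and "\<And>T. T \<subseteq> K \<Longrightarrow> 2 * hamming_weight m (\<lambda>i. x i + (\<Sum>j\<in>T. h j i)) = m"
  shows "2 * card {i \<in> {..<m}. direction_class K h i = S \<and> x i = 1} = class_size m K h S"
proof -
  let ?C = "direction_class K h"
  define \<sigma> where "\<sigma> = (\<lambda>i. if x i = 1 then - 1 else (1 :: int))"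
  have zero: "(\<Sum>i<m. \<sigma> i * (- 1) ^ card (T \<inter> ?C i)) = 0" if T: "T \<in> Pow K" for T
  proof -
    have "(\<Sum>i<m. \<sigma> i * (- 1) ^ card (T \<inter> ?C i)) =
        (\<Sum>i<m. 1 - 2 * of_bool (x i + (\<Sum>j\<in>T. h j i) = 1))"
      using T assms(1) by (intro sum.cong refl) (auto simp: \<sigma>_def shift_eq_one_iff)
    also have "\<dots> = int m - 2 * int (hamming_weight m (\<lambda>i. x i + (\<Sum>j\<in>T. h j i)))"
      unfolding hamming_weight_eq_sum sum_subtractf sum_distrib_left by simp
    finally show ?thesis
      using assms(3)[of T] T by simp
  qed
  have "0 = (\<Sum>T\<in>Pow K. (- 1) ^ card (T \<inter> S) * (\<Sum>i<m. \<sigma> i * (- 1) ^ card (T \<inter> ?C i)))"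
    using zero by simp
  also have "\<dots> = (\<Sum>i<m. \<sigma> i * (\<Sum>T\<in>Pow K. (- 1) ^ card (T \<inter> S) * (- 1) ^ card (T \<inter> ?C i)))"
    unfolding sum_distrib_left by (subst sum.swap) (simp add: mult_ac)
  also have "\<dots> = (\<Sum>i<m. if ?C i = S then \<sigma> i * 2 ^ card K else 0)"
    using assms(1,2) by (intro sum.cong refl)
      (auto simp: sum_minus_one_power_card_Int direction_class_subset)
  also have "\<dots> = (\<Sum>i\<in>{i \<in> {..<m}. ?C i = S}. \<sigma> i) * 2 ^ card K"
    unfolding sum_distrib_right by (subst sum.inter_filter) auto
  finally have "(\<Sum>i\<in>{i \<in> {..<m}. ?C i = S}. \<sigma> i) = 0"
    by simp
  moreover have "(\<Sum>i\<in>{i \<in> {..<m}. ?C i = S}. \<sigma> i) =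
      (\<Sum>i\<in>{i \<in> {..<m}. ?C i = S}. 1 - 2 * of_bool (x i = 1))"
    by (intro sum.cong) (auto simp: \<sigma>_def)
  moreover have "\<dots> = int (class_size m K h S) - 2 * (\<Sum>i\<in>{i \<in> {..<m}. ?C i = S}. of_bool (x i = 1))"
    unfolding sum_subtractf sum_distrib_left by (simp add: class_size_def)
  moreover have "(\<Sum>i\<in>{i \<in> {..<m}. ?C i = S}. of_bool (x i = 1)) =
      int (card {i \<in> {..<m}. ?C i = S \<and> x i = 1})"
    by (simp add: sum.If_cases of_bool_def Int_def conj_ac)
  ultimately show ?thesis
    by linarith
qed

section \<open>Central binomial probabilities and balanced base points\<close>

text \<open>The probability that \<open>m\<close> fair bits contain as many ones as zeros, hence 0
  for odd \<open>m\<close>.\<close>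

definition central_prob :: "nat \<Rightarrow> real" where
  "central_prob m = (if even m then (m choose (m div 2)) / 2 ^ m else 0)"

lemma central_prob_nonneg: "0 \<le> central_prob m"
  by (simp add: central_prob_def)

lemma central_prob_le_1: "central_prob m \<le> 1"
proof -
  have "real (m choose (m div 2)) \<le> 2 ^ m"
    using binomial_le_pow2[of m "m div 2"] by (simp flip: of_nat_le_iff)
  then show ?thesis
    by (simp add: central_prob_def divide_le_eq)
qed

text \<open>A base point is determined by its sets of ones in the single classes, and by
  \<open>class_balanced\<close> each of these fills exactly half of its class. The product counts
  the tuples of such halves.\<close>

lemma card_balanced_le:
  assumes "finite K"
  shows "card {x \<in> cube m. \<forall>T\<in>Pow K. 2 * hamming_weight m (\<lambda>i. x i + (\<Sum>j\<in>T. h j i)) = m} / 2 ^ m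
    \<le> (\<Prod>S\<in>Pow K. central_prob (class_size m K h S))"
proof -
  let ?C = "\<lambda>S. {i \<in> {..<m}. direction_class K h i = S}"
  let ?N = "class_size m K h"
  define Y where "Y = {x \<in> cube m. \<forall>T\<in>Pow K. 2 * hamming_weight m (\<lambda>i. x i + (\<Sum>j\<in>T. h j i)) = m}"
  define B where "B = (\<lambda>S. {A. A \<subseteq> ?C S \<and> 2 * card A = ?N S})"
  define f where "f = (\<lambda>x :: nat \<Rightarrow> bit. \<lambda>S\<in>Pow K. {i \<in> {..<m}. direction_class K h i = S \<and> x i = 1})"
  have cardB: "card (B S) = 2 ^ ?N S * central_prob (?N S)" for S
  proof (cases "even (?N S)")
    case True
    then have "B S = {A. A \<subseteq> ?C S \<and> card A = ?N S div 2}"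
      by (auto simp: B_def)
    then show ?thesis
      using True n_subsets[of "?C S" "?N S div 2"] by (simp add: central_prob_def class_size_def)
  next
    case False
    then have "B S = {}"
      unfolding B_def by (metis (mono_tags, lifting) Collect_empty_eq dvd_triv_left)
    then show ?thesis
      using False by (simp add: central_prob_def)
  qed
  have "inj_on f Y"
  proof (rule inj_onI)
    fix x y assume xy: "x \<in> Y" "y \<in> Y" "f x = f y"
    have "x i = y i" for i
    proof (cases "i < m")
      case True
      have "f x (direction_class K h i) = f y (direction_class K h i)"
        using xy by simp
      then have "x i = 1 \<longleftrightarrow> y i = 1"
        using True direction_class_subset[of K h i] by (auto simp: f_def)
      then show ?thesis
        by (cases "x i"; cases "y i") auto
    next
      case False
      then show ?thesis
        using xy by (simp add: Y_def cube_def)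
    qed
    then show "x = y" ..
  qed
  moreover have "f ` Y \<subseteq> (\<Pi>\<^sub>E S\<in>Pow K. B S)"
  proof (intro image_subsetI PiE_I)
    fix x S assume "x \<in> Y" "S \<in> Pow K"
    then show "f x S \<in> B S"
      using class_balanced[OF assms, of S m x h] by (auto simp: f_def B_def Y_def)
  qed (simp add: f_def)
  moreover have "finite (\<Pi>\<^sub>E S\<in>Pow K. B S)"
    using assms by (intro finite_PiE) (auto simp: B_def)
  ultimately have "card Y \<le> card (\<Pi>\<^sub>E S\<in>Pow K. B S)"
    by (rule card_inj_on_le)
  also have "real \<dots> = (\<Prod>S\<in>Pow K. 2 ^ ?N S) * (\<Prod>S\<in>Pow K. central_prob (?N S))"
    using assms by (simp add: card_PiE cardB prod.distrib)
  also have "(\<Prod>S\<in>Pow K. 2 ^ ?N S :: real) = 2 ^ m"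
    using assms by (simp add: sum_class_size flip: power_sum)
  finally show ?thesis
    by (simp add: Y_def divide_le_eq mult.commute)
qed

lemma central_prob_Suc:
  "central_prob (2 * Suc j) * (2 * j + 2) = central_prob (2 * j) * (2 * j + 1)"
proof -
  \<comment> \<open>The denominator of the central probability written with factorials; multiplying
    by it reduces the recursion to one for \<open>fact\<close>.\<close>
  define q :: "nat \<Rightarrow> real" where "q = (\<lambda>j. fact j * fact j * 4 ^ j)"
  have cp: "central_prob (2 * j) * q j = fact (2 * j)" for j
    using binomial_fact[of j "2 * j", where 'a = real]
    by (simp add: central_prob_def power_mult q_def)
  have "(central_prob (2 * Suc j) * (2 * j + 2)) * ((2 * j + 2) * q j) = fact (2 * Suc j)"
    unfolding cp[symmetric] by (simp add: q_def algebra_simps)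
  also have "\<dots> = real (2 * j + 2) * (real (2 * j + 1) * fact (2 * j))"
    by (simp add: algebra_simps)
  also have "\<dots> = real (2 * j + 2) * (real (2 * j + 1) * (central_prob (2 * j) * q j))"
    unfolding cp ..
  also have "\<dots> = (central_prob (2 * j) * (2 * j + 1)) * ((2 * j + 2) * q j)"
    by (simp only: mult_ac)
  finally have "(central_prob (2 * Suc j) * (2 * j + 2)) * ((2 * j + 2) * q j) =
      (central_prob (2 * j) * (2 * j + 1)) * ((2 * j + 2) * q j)" .
  moreover have "(2 * j + 2) * q j \<noteq> 0"
    by (simp add: q_def)
  ultimately show ?thesis
    by (metis mult_right_cancel)
qed

text \<open>By the recursion this comes down to 4j(j + 1) <= (2j + 1)^2. The monotonicity does the
  work of Stirling's formula: it compares a class with the whole set of coordinates, and comparison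
  with \<open>i = 1\<close> bounds \<open>central_prob\<close> from below.\<close>

lemma central_prob_sqrt_mono:
  assumes "i \<le> j"
  shows "(central_prob (2 * i))\<^sup>2 * i \<le> (central_prob (2 * j))\<^sup>2 * j"
  using assms
proof (induction j rule: dec_induct)
  case (step j)
  define b where "b = central_prob (2 * j)"
  have eq: "central_prob (2 * Suc j) = b * (2 * j + 1) / (2 * j + 2)"
    using central_prob_Suc[of j] by (simp add: b_def field_simps)
  have "real j * (2 * real j + 2)\<^sup>2 \<le> (2 * real j + 1)\<^sup>2 * (real j + 1)"
    by (simp add: power2_eq_square algebra_simps)
  then have "b\<^sup>2 * j \<le> b\<^sup>2 * ((2 * real j + 1)\<^sup>2 * (real j + 1) / (2 * real j + 2)\<^sup>2)"
    by (intro mult_left_mono) (simp_all add: le_divide_eq)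
  also have "\<dots> = (central_prob (2 * Suc j))\<^sup>2 * Suc j"
    unfolding eq by (simp add: power_mult_distrib power_divide add.commute mult_ac)
  finally show ?case
    using step.IH by (simp add: b_def)
qed simp

lemma central_prob_le:
  assumes "0 < N" "N \<le> 2 * n"
  shows "central_prob N \<le> of_bool (even N) * (central_prob (2 * n) * sqrt (2 * n / N))"
proof (cases "even N")
  case True
  then obtain j where j: "N = 2 * j" by auto
  have "(central_prob N)\<^sup>2 * j \<le> (central_prob (2 * n))\<^sup>2 * n"
    using central_prob_sqrt_mono[of j n] assms by (simp add: j)
  then have "(central_prob N)\<^sup>2 \<le> (central_prob (2 * n))\<^sup>2 * (2 * n / N)"
    using assms by (simp add: j field_simps)
  then have "(central_prob N)\<^sup>2 \<le> (central_prob (2 * n) * sqrt (2 * n / N))\<^sup>2"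
    by (simp add: power_mult_distrib)
  then have "central_prob N \<le> central_prob (2 * n) * sqrt (2 * n / N)"
    by (rule power2_le_imp_le) (simp add: central_prob_nonneg)
  then show ?thesis
    using True by simp
qed (simp add: central_prob_def)

lemma central_prob_ge:
  assumes "n > 0"
  shows "1 \<le> 4 * n * (central_prob (2 * n))\<^sup>2"
proof -
  have *: "central_prob 2 = 1 / 2"
    by (simp add: central_prob_def)
  show ?thesis
    using central_prob_sqrt_mono[of 1 n] assms by (simp add: * power2_eq_square mult_ac)
qed

section \<open>The distribution of the class sizes\<close>

text \<open>The generating function of the multinomially distributed class sizes. Signs as arguments
  detect parities, and one argument below 1 gives a tail bound.\<close>

lemma sum_prod_power_class_size:
  fixes a :: "nat set \<Rightarrow> real"
  assumes "finite K"
  shows "(\<Sum>h\<in>K \<rightarrow>\<^sub>E cube m. \<Prod>S\<in>Pow K. a S ^ class_size m K h S) = (\<Sum>S\<in>Pow K. a S) ^ m"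
  unfolding prod_power_class_size[OF assms] using assms
  by (simp add: sum_prod_direction_class[of K "\<lambda>_. a"])

text \<open>Evenness of all sizes is an average over the sign patterns
  \<open>A \<subseteq> Pow K\<close>, and the pattern \<open>A\<close> sums to
  \<open>q A ^ m\<close>. Only the two constant patterns reach the size \<open>P\<close>, which
  explains the numerator 2: the sizes add up to \<open>m\<close>, so the last parity is determined
  by the others.\<close>

lemma all_classes_even_bound:
  fixes K :: "nat set"
  assumes "finite K"
  obtains \<rho> :: real where "0 \<le> \<rho>" "\<rho> < 1"
    "\<And>m. (\<Sum>h\<in>K \<rightarrow>\<^sub>E cube m. of_bool (\<forall>S\<in>Pow K. even (class_size m K h S)))
      \<le> 2 ^ (m * card K) * (2 / 2 ^ 2 ^ card K + \<rho> ^ m)"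
proof -
  define P :: real where "P = 2 ^ card K"
  define X where "X = Pow (Pow K) - {{}, Pow K}"
  define w where "w = (\<lambda>A (S :: nat set). if S \<in> A then - 1 else (1 :: real))"
  define q where "q = (\<lambda>A. \<Sum>S\<in>Pow K. w A S)"
  have P: "P > 0" "card (Pow K) = P"
    using assms by (auto simp: P_def card_Pow)
  have fin: "finite (Pow K)" "finite X"
    using assms by (auto simp: X_def)
  have q_le: "\<bar>q A\<bar> \<le> P" for A
    using sum_abs[of "w A" "Pow K"] P by (simp add: q_def w_def if_distrib cong: if_cong)
  have q_less: "\<bar>q A\<bar> / P < 1" if "A \<in> X" for A
  proof -
    have A: "A \<subseteq> Pow K" "A \<noteq> {}" "A \<noteq> Pow K"
      using that by (auto simp: X_def)
    then have "finite A"
      using fin by (auto dest: finite_subset)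
    have "q A = - real (card A) + real (card (Pow K - A))"
      unfolding q_def w_def using fin A
      by (subst sum.If_cases) (auto simp: Int_absorb1 Diff_eq)
    also have "real (card (Pow K - A)) = P - card A"
      using A fin P card_mono[of "Pow K" A] by (simp add: card_Diff_subset \<open>finite A\<close> of_nat_diff)
    finally have "q A = P - 2 * card A"
      by simp
    moreover have "0 < card A" "card A < card (Pow K)"
      using A fin \<open>finite A\<close> by (auto simp: card_gt_0_iff intro: psubset_card_mono)
    ultimately have "\<bar>q A\<bar> < P"
      using P(2) by linarith
    then show ?thesis
      using P by simp
  qed
  obtain \<rho> where \<rho>: "0 \<le> \<rho>" "\<rho> < 1" "\<And>A. A \<in> X \<Longrightarrow> \<bar>q A\<bar> / P \<le> \<rho>"
    using finite_uniform_less_one[of X "\<lambda>A. \<bar>q A\<bar> / P"] fin(2) q_less by metis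
  show ?thesis
  proof (rule that[OF \<rho>(1,2)])
    fix m
    have ind: "of_bool (\<forall>S\<in>Pow K. even (class_size m K h S)) =
        (\<Sum>A\<in>Pow (Pow K). \<Prod>S\<in>Pow K. w A S ^ class_size m K h S) / 2 ^ 2 ^ card K" for h
    proof -
      have "(\<Sum>A\<in>Pow (Pow K). \<Prod>S\<in>Pow K. w A S ^ class_size m K h S) =
          (\<Sum>A\<in>Pow (Pow K). (\<Prod>S\<in>A. (- 1) ^ class_size m K h S) * (\<Prod>S\<in>Pow K - A. 1))"
      proof (rule sum.cong[OF refl])
        fix A assume "A \<in> Pow (Pow K)"
        then have "A \<subseteq> Pow K"
          by simp
        have "(\<Prod>S\<in>Pow K. w A S ^ class_size m K h S) =
            (\<Prod>S\<in>Pow K. if S \<in> A then (- 1) ^ class_size m K h S else 1)"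
          by (intro prod.cong) (auto simp: w_def)
        also have "\<dots> = (\<Prod>S\<in>A. (- 1) ^ class_size m K h S)"
          using fin(1) \<open>A \<subseteq> Pow K\<close> by (simp add: prod.If_cases Int_absorb1)
        finally show "(\<Prod>S\<in>Pow K. w A S ^ class_size m K h S) =
            (\<Prod>S\<in>A. (- 1) ^ class_size m K h S) * (\<Prod>S\<in>Pow K - A. 1)"
          by simp
      qed
      also have "\<dots> = (\<Prod>S\<in>Pow K. (- 1) ^ class_size m K h S + 1)"
        by (rule prod_add[OF fin(1), symmetric])
      also have "\<dots> = (\<Prod>S\<in>Pow K. 2 * of_bool (even (class_size m K h S)))"
        by (intro prod.cong) auto
      also have "\<dots> = 2 ^ 2 ^ card K * of_bool (\<forall>S\<in>Pow K. even (class_size m K h S))"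
        using fin(1) assms by (auto simp: prod.distrib card_Pow)
      finally show ?thesis
        by simp
    qed
    have "(\<Sum>A\<in>{{}, Pow K}. q A ^ m) \<le> (\<Sum>A\<in>{{}, Pow K}. P ^ m)"
      by (rule sum_mono, rule order_trans[OF abs_ge_self]) (simp add: power_abs power_mono q_le)
    moreover have "card {{}, Pow K} = 2"
      by (metis Pow_not_empty card_2_iff)
    ultimately have "(\<Sum>A\<in>{{}, Pow K}. q A ^ m) \<le> 2 * P ^ m"
      by simp
    moreover have "(\<Sum>A\<in>X. q A ^ m) \<le> 2 ^ 2 ^ card K * (\<rho> * P) ^ m"
    proof -
      have "(\<Sum>A\<in>X. q A ^ m) \<le> (\<Sum>A\<in>X. (\<rho> * P) ^ m)"
      proof (rule sum_mono, rule order_trans[OF abs_ge_self])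
        fix A assume "A \<in> X"
        then have "\<bar>q A\<bar> \<le> \<rho> * P"
          using \<rho>(3)[of A] P(1) by (simp add: divide_le_eq)
        then show "\<bar>q A ^ m\<bar> \<le> (\<rho> * P) ^ m"
          by (simp add: power_abs power_mono)
      qed
      also have "\<dots> = card X * (\<rho> * P) ^ m"
        by simp
      also have "\<dots> \<le> 2 ^ 2 ^ card K * (\<rho> * P) ^ m"
      proof (rule mult_right_mono)
        have "card X \<le> card (Pow (Pow K))"
          using fin by (intro card_mono) (auto simp: X_def)
        also have "\<dots> = 2 ^ 2 ^ card K"
          using assms by (simp add: card_Pow)
        finally show "real (card X) \<le> 2 ^ 2 ^ card K"
          by (metis of_nat_le_iff of_nat_numeral of_nat_power)
      qed (use \<rho>(1) P(1) in simp)
      finally show ?thesis .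
    qed
    moreover have "(\<Sum>A\<in>Pow (Pow K). q A ^ m) = (\<Sum>A\<in>{{}, Pow K}. q A ^ m) + (\<Sum>A\<in>X. q A ^ m)"
      unfolding X_def using fin by (subst sum.subset_diff[of "{{}, Pow K}"]) auto
    ultimately have "(\<Sum>A\<in>Pow (Pow K). q A ^ m) \<le> 2 * P ^ m + 2 ^ 2 ^ card K * (\<rho> * P) ^ m"
      by linarith
    moreover have "(\<Sum>h\<in>K \<rightarrow>\<^sub>E cube m. of_bool (\<forall>S\<in>Pow K. even (class_size m K h S))) =
        (\<Sum>A\<in>Pow (Pow K). q A ^ m) / 2 ^ 2 ^ card K"
      unfolding ind sum_divide_distrib[symmetric] q_def
      by (subst sum.swap) (simp add: sum_prod_power_class_size[OF assms])
    ultimately have "(\<Sum>h\<in>K \<rightarrow>\<^sub>E cube m. of_bool (\<forall>S\<in>Pow K. even (class_size m K h S))) \<le>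
        (2 * P ^ m + 2 ^ 2 ^ card K * (\<rho> * P) ^ m) / 2 ^ 2 ^ card K"
      by (simp add: divide_right_mono)
    also have "\<dots> = P ^ m * (2 / 2 ^ 2 ^ card K + \<rho> ^ m)"
      by (simp add: field_simps power_mult_distrib)
    finally show "(\<Sum>h\<in>K \<rightarrow>\<^sub>E cube m. of_bool (\<forall>S\<in>Pow K. even (class_size m K h S)))
        \<le> 2 ^ (m * card K) * (2 / 2 ^ 2 ^ card K + \<rho> ^ m)"
      by (simp add: P_def mult.commute flip: power_mult)
  qed
qed

text \<open>Since \<open>z\<close> lies strictly between \<open>1 - \<eta>\<close> and 1, the
  estimate - ln z <= 1/z - 1 makes \<open>(1 - \<eta>) * - ln z\<close> smaller than
  \<open>1 - z\<close>. After 1 + t <= exp t this says that the exponent is negative.\<close>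

lemma Chernoff_base_less_one:
  fixes \<eta> P :: real
  assumes "0 < \<eta>" "\<eta> < 1" "1 \<le> P"
  defines "z \<equiv> 1 - \<eta> / 2"
  shows "(1 - (1 - z) / P) * z powr (- ((1 - \<eta>) / P)) < 1"
proof -
  have z: "0 < z" "z < 1" "1 - \<eta> < z"
    using assms by (auto simp: z_def)
  have "- ln z \<le> 1 / z - 1"
    using ln_le_minus_one[of "1 / z"] z by (simp add: ln_div)
  then have "(1 - \<eta>) * - ln z \<le> (1 - \<eta>) * (1 / z - 1)"
    using assms by (intro mult_left_mono) auto
  also have "\<dots> < z * (1 / z - 1)"
    using z by (intro mult_strict_right_mono) auto
  also have "\<dots> = 1 - z"
    using z by (simp add: field_simps)
  finally have "- (1 - z) + - (1 - \<eta>) * ln z < 0"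
    by (simp add: algebra_simps)
  then have neg: "(- (1 - z) + - (1 - \<eta>) * ln z) / P < 0"
    using assms by (simp add: divide_neg_pos)
  have "1 - (1 - z) / P \<le> exp (- ((1 - z) / P))"
    using exp_ge_add_one_self[of "- ((1 - z) / P)"] by simp
  then have "(1 - (1 - z) / P) * z powr (- ((1 - \<eta>) / P)) \<le>
      exp (- ((1 - z) / P)) * z powr (- ((1 - \<eta>) / P))"
    by (rule mult_right_mono) simp
  also have "\<dots> = exp ((- (1 - z) + - (1 - \<eta>) * ln z) / P)"
  proof -
    have "- ((1 - z) / P) + - ((1 - \<eta>) / P) * ln z = (- (1 - z) + - (1 - \<eta>) * ln z) / P"
      by (simp add: add_divide_distrib minus_divide_left)
    then show ?thesis
      using z by (simp add: powr_def flip: exp_add)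
  qed
  also have "\<dots> < 1"
    using neg by simp
  finally show ?thesis .
qed

text \<open>Chernoff's bound for the lower tail: a coordinate falls into the class \<open>S\<close>
  with probability \<open>1 / P\<close>, independently of the others.\<close>

lemma small_class_bound:
  fixes K :: "nat set" and \<eta> :: real
  assumes "finite K" "0 < \<eta>" "\<eta> < 1"
  obtains \<rho> :: real where "0 \<le> \<rho>" "\<rho> < 1"
    "\<And>m S. S \<subseteq> K \<Longrightarrow>
      (\<Sum>h\<in>K \<rightarrow>\<^sub>E cube m. of_bool (class_size m K h S < (1 - \<eta>) * m / 2 ^ card K))
        \<le> 2 ^ (m * card K) * \<rho> ^ m"
proof -
  define P :: real where "P = 2 ^ card K"
  define z where "z = 1 - \<eta> / 2"
  define c where "c = (1 - \<eta>) / P"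
  define \<rho> where "\<rho> = (1 - (1 - z) / P) * z powr (- c)"
  have P: "P \<ge> 1" "card (Pow K) = P"
    using assms by (auto simp: P_def card_Pow)
  have z: "0 < z" "z < 1"
    using assms by (auto simp: z_def)
  have "(1 - z) / P \<le> 1"
    using P z by (simp add: divide_le_eq)
  then have "0 \<le> \<rho>"
    by (simp add: \<rho>_def)
  moreover have "\<rho> < 1"
    unfolding \<rho>_def c_def z_def using assms P by (intro Chernoff_base_less_one)
  moreover have "(\<Sum>h\<in>K \<rightarrow>\<^sub>E cube m. of_bool (class_size m K h S < (1 - \<eta>) * m / 2 ^ card K))
      \<le> 2 ^ (m * card K) * \<rho> ^ m" if S: "S \<subseteq> K" for m S
  proof -
    have "(\<Sum>h\<in>K \<rightarrow>\<^sub>E cube m. of_bool (class_size m K h S < (1 - \<eta>) * m / 2 ^ card K))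
        \<le> (\<Sum>h\<in>K \<rightarrow>\<^sub>E cube m. z ^ class_size m K h S * z powr (- (c * m)))"
    proof (rule sum_mono)
      fix h
      \<comment> \<open>As \<open>z < 1\<close>, the exponential weight is at least 1 when the class
        is small, and it is positive otherwise.\<close>
      have "1 \<le> z ^ class_size m K h S * z powr (- (c * m))"
        if "class_size m K h S < (1 - \<eta>) * m / 2 ^ card K"
      proof -
        have "z powr 0 \<le> z powr (class_size m K h S + - (c * m))"
          using that z by (intro powr_mono') (auto simp: c_def P_def)
        then show ?thesis
          using z by (simp flip: powr_add powr_realpow)
      qed
      then show "of_bool (class_size m K h S < (1 - \<eta>) * m / 2 ^ card K)
          \<le> z ^ class_size m K h S * z powr (- (c * m))"
        using z by auto
    qed
    also have "\<dots> = (\<Sum>h\<in>K \<rightarrow>\<^sub>E cube m. \<Prod>S'\<in>Pow K. (if S' = S then z else 1) ^ class_size m K h S')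
        * z powr (- (c * m))"
    proof -
      have "(\<Prod>S'\<in>Pow K. (if S' = S then z else 1) ^ class_size m K h S') = z ^ class_size m K h S" for h
      proof -
        have "(\<Prod>S'\<in>Pow K. (if S' = S then z else 1) ^ class_size m K h S') =
            (\<Prod>S'\<in>Pow K. if S' = S then z ^ class_size m K h S' else 1)"
          by (intro prod.cong) auto
        then show ?thesis
          using S assms(1) by (simp add: prod.delta)
      qed
      then show ?thesis
        by (simp add: sum_distrib_right)
    qed
    also have "\<dots> = (\<Sum>S'\<in>Pow K. if S' = S then z else 1) ^ m * z powr (- (c * m))"
      by (simp only: sum_prod_power_class_size[OF assms(1)])
    also have "(\<Sum>S'\<in>Pow K. if S' = S then z else 1) = P * (1 - (1 - z) / P)"
    proof -
      have "(\<Sum>S'\<in>Pow K. if S' = S then z else 1) = (\<Sum>S'\<in>Pow K. 1 + (if S' = S then z - 1 else 0))"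
        by (intro sum.cong) auto
      also have "\<dots> = P + (z - 1)"
        using S assms(1) P(2) unfolding sum.distrib by simp
      also have "\<dots> = P * (1 - (1 - z) / P)"
        using P(1) by (simp add: field_simps)
      finally show ?thesis .
    qed
    also have "z powr (- (c * m)) = (z powr (- c)) ^ m"
      using z by (simp add: powr_powr flip: powr_realpow)
    finally show ?thesis
      by (simp add: \<rho>_def P_def power_mult_distrib mult.commute mult.left_commute flip: power_mult)
  qed
  ultimately show ?thesis
    by (rule that)
qed

section \<open>The Gowers norm of the middle slice\<close>

lemma cube_shift:
  assumes "x \<in> cube m" "h \<in> K \<rightarrow>\<^sub>E cube m" "T \<subseteq> K"
  shows "(\<lambda>i. x i + (\<Sum>j\<in>T. h j i)) \<in> cube m"
  using assms by (auto simp: cube_def PiE_iff intro!: sum.neutral)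

text \<open>The normalized indicator of the slice as a real function:
  \<open>central_prob (2 * n)\<close> is the density of the slice, see
  \<open>card_middle_slice\<close>.\<close>

definition middle_density :: "nat \<Rightarrow> (nat \<Rightarrow> bit) \<Rightarrow> real" where
  "middle_density n x = indicator (middle_slice n) x / central_prob (2 * n)"

lemma gowers_sum_middle_density:
  assumes "finite K"
  shows "gowers_sum (2 * n) K (\<lambda>_. middle_density n) =
    (\<Sum>h\<in>K \<rightarrow>\<^sub>E cube (2 * n). card {x \<in> cube (2 * n).
        \<forall>T\<in>Pow K. 2 * hamming_weight (2 * n) (\<lambda>i. x i + (\<Sum>j\<in>T. h j i)) = 2 * n})
      / central_prob (2 * n) ^ 2 ^ card K"
proof -
  let ?W = "\<lambda>x h T. hamming_weight (2 * n) (\<lambda>i. x i + (\<Sum>j\<in>T. h j i))"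
  let ?c = "central_prob (2 * n) ^ 2 ^ card K"
  have "gowers_sum (2 * n) K (\<lambda>_. middle_density n) =
      (\<Sum>x\<in>cube (2 * n). \<Sum>h\<in>K \<rightarrow>\<^sub>E cube (2 * n). of_bool (\<forall>T\<in>Pow K. 2 * ?W x h T = 2 * n) / ?c)"
    unfolding gowers_sum_def
  proof (intro sum.cong refl)
    fix x h assume xh: "x \<in> cube (2 * n)" "h \<in> K \<rightarrow>\<^sub>E cube (2 * n)"
    have "(\<Prod>T\<in>Pow K. middle_density n (\<lambda>i. x i + (\<Sum>j\<in>T. h j i))) =
        (\<Prod>T\<in>Pow K. of_bool (2 * ?W x h T = 2 * n) / central_prob (2 * n))"
      using cube_shift[OF xh]
      by (intro prod.cong refl) (auto simp: middle_density_def middle_slice_def indicator_def)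
    also have "\<dots> = of_bool (\<forall>T\<in>Pow K. 2 * ?W x h T = 2 * n) / ?c"
      using assms by (auto simp: prod_dividef card_Pow)
    finally show "(\<Prod>T\<in>Pow K. middle_density n (\<lambda>i. x i + (\<Sum>j\<in>T. h j i))) = \<dots>" .
  qed
  also have "\<dots> = (\<Sum>h\<in>K \<rightarrow>\<^sub>E cube (2 * n). \<Sum>x\<in>cube (2 * n). of_bool (\<forall>T\<in>Pow K. 2 * ?W x h T = 2 * n)) / ?c"
    by (subst sum.swap) (simp only: sum_divide_distrib)
  also have "(\<lambda>h. \<Sum>x\<in>cube (2 * n). of_bool (\<forall>T\<in>Pow K. 2 * ?W x h T = 2 * n) :: real) =
      (\<lambda>h. card {x \<in> cube (2 * n). \<forall>T\<in>Pow K. 2 * ?W x h T = 2 * n})"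
    by (simp add: finite_cube of_bool_def sum.If_cases Int_def)
  finally show ?thesis by simp
qed

text \<open>If no class is small, each factor is at most \<open>b * sqrt Y\<close> by comparison
  with all \<open>2 * n\<close> coordinates. The number of classes is even since \<open>K\<close> is
  nonempty, so the roots pair up to a power of \<open>Y\<close>. If some class is small, the product
  is at most 1 and the last sum is at least 1.\<close>

lemma prod_central_prob_le:
  fixes K :: "nat set" and \<eta> :: real
  assumes "finite K" "K \<noteq> {}" "0 < \<eta>" "\<eta> < 1" "n > 0"
  shows "(\<Prod>S\<in>Pow K. central_prob (class_size (2 * n) K h S)) \<le>
    of_bool (\<forall>S\<in>Pow K. even (class_size (2 * n) K h S)) *
      (central_prob (2 * n) ^ 2 ^ card K * (2 ^ card K / (1 - \<eta>)) ^ 2 ^ (card K - 1)) +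
    (\<Sum>S\<in>Pow K. of_bool (class_size (2 * n) K h S < (1 - \<eta>) * real (2 * n) / 2 ^ card K))"
proof -
  define P :: real where "P = 2 ^ card K"
  define Y where "Y = P / (1 - \<eta>)"
  define b where "b = central_prob (2 * n)"
  let ?N = "class_size (2 * n) K h"
  have P: "P > 0" and Y: "Y > 0"
    using assms by (auto simp: P_def Y_def)
  have main: "(\<Prod>S\<in>Pow K. central_prob (?N S)) \<le>
      of_bool (\<forall>S\<in>Pow K. even (?N S)) * (b ^ 2 ^ card K * Y ^ 2 ^ (card K - 1))"
    if large: "\<And>S. S \<in> Pow K \<Longrightarrow> (1 - \<eta>) * real (2 * n) / P \<le> ?N S"
  proof -
    have "(\<Prod>S\<in>Pow K. central_prob (?N S)) \<le> (\<Prod>S\<in>Pow K. of_bool (even (?N S)) * (b * sqrt Y))"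
    proof (intro prod_mono conjI central_prob_nonneg)
      fix S assume S: "S \<in> Pow K"
      have "0 < (1 - \<eta>) * real (2 * n) / P"
        using assms P by simp
      then have pos: "0 < ?N S"
        using large[OF S] by linarith
      have "?N S \<le> 2 * n"
        using member_le_sum[of S "Pow K" ?N] S assms(1) by (simp add: sum_class_size)
      then have "central_prob (?N S) \<le> of_bool (even (?N S)) * (b * sqrt (2 * n / ?N S))"
        using central_prob_le[OF pos] by (simp add: b_def)
      also have "2 * n / ?N S \<le> Y"
        using large[OF S] pos P assms by (simp add: Y_def field_simps)
      then have "of_bool (even (?N S)) * (b * sqrt (2 * n / ?N S)) \<le> of_bool (even (?N S)) * (b * sqrt Y)"
        by (intro mult_left_mono) (auto simp: b_def central_prob_nonneg)
      finally show "central_prob (?N S) \<le> of_bool (even (?N S)) * (b * sqrt Y)" .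
    qed
    also have "\<dots> = of_bool (\<forall>S\<in>Pow K. even (?N S)) * (b * sqrt Y) ^ 2 ^ card K"
      using assms(1) by (auto simp: prod.distrib card_Pow power_mult_distrib)
    also have "sqrt Y ^ 2 ^ card K = Y ^ 2 ^ (card K - 1)"
    proof -
      have "card K = Suc (card K - 1)"
        using assms by (simp add: card_gt_0_iff)
      then have "(2 :: nat) ^ card K = 2 * 2 ^ (card K - 1)"
        by (metis power_Suc)
      then show ?thesis
        using Y by (simp add: power_mult)
    qed
    then have "(b * sqrt Y) ^ 2 ^ card K = b ^ 2 ^ card K * Y ^ 2 ^ (card K - 1)"
      by (simp add: power_mult_distrib)
    finally show ?thesis .
  qed
  show ?thesis
  proof (cases "\<exists>S\<in>Pow K. ?N S < (1 - \<eta>) * real (2 * n) / P")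
    case True
    then obtain S where S: "S \<in> Pow K" "?N S < (1 - \<eta>) * real (2 * n) / P" ..
    have "(\<Prod>S\<in>Pow K. central_prob (?N S)) \<le> 1"
      by (intro prod_le_1) (simp add: central_prob_nonneg central_prob_le_1)
    also have "1 \<le> (\<Sum>S\<in>Pow K. of_bool (?N S < (1 - \<eta>) * real (2 * n) / P) :: real)"
      using member_le_sum[of S "Pow K" "\<lambda>S. of_bool (?N S < (1 - \<eta>) * real (2 * n) / P) :: real"] S assms(1)
      by simp
    also have "\<dots> \<le> of_bool (\<forall>S\<in>Pow K. even (?N S)) * (b ^ 2 ^ card K * Y ^ 2 ^ (card K - 1)) + \<dots>"
      using Y by (simp add: b_def central_prob_nonneg)
    finally show ?thesis
      unfolding b_def Y_def P_def .
  next
    case False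
    then have "(\<Prod>S\<in>Pow K. central_prob (?N S)) \<le>
        of_bool (\<forall>S\<in>Pow K. even (?N S)) * (b ^ 2 ^ card K * Y ^ 2 ^ (card K - 1))"
      by (intro main) (meson not_le)
    then show ?thesis
      unfolding b_def Y_def P_def by (rule add_increasing2[OF sum_nonneg, rotated]) simp
  qed
qed

lemma gowers_middle_density_bound:
  fixes K :: "nat set" and \<eta> :: real
  assumes "finite K" "K \<noteq> {}" "0 < \<eta>" "\<eta> < 1"
  obtains e :: "nat \<Rightarrow> real" where "e \<longlonglongrightarrow> 0"
    "\<And>n. n > 0 \<Longrightarrow> gowers_sum (2 * n) K (\<lambda>_. middle_density n) / 2 ^ (2 * n * (card K + 1)) \<le>
      card (parity_relations (2 ^ (card K - 1)) K) / (1 - \<eta>) ^ 2 ^ (card K - 1) + e n"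
proof -
  define k where "k = card K"
  define P :: real where "P = 2 ^ k"
  define Q :: nat where "Q = 2 ^ (k - 1)"
  define Y where "Y = P / (1 - \<eta>)"
  define C where "C = real (card (parity_relations (2 ^ (k - 1)) K))"
  have k: "k > 0" "2 ^ k = 2 * Q"
    using assms by (auto simp: k_def Q_def card_gt_0_iff simp flip: power_Suc)
  have P: "P > 0" "card (Pow K) = P" and Y: "Y > 0"
    using assms by (auto simp: P_def Y_def k_def card_Pow)
  obtain \<rho>1 :: real where \<rho>1: "0 \<le> \<rho>1" "\<rho>1 < 1"
    "\<And>m. (\<Sum>h\<in>K \<rightarrow>\<^sub>E cube m. of_bool (\<forall>S\<in>Pow K. even (class_size m K h S)))
      \<le> 2 ^ (m * k) * (2 / 2 ^ 2 ^ k + \<rho>1 ^ m)"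
    by (fact all_classes_even_bound[OF assms(1), folded k_def])
  obtain \<rho>2 :: real where \<rho>2: "0 \<le> \<rho>2" "\<rho>2 < 1"
    "\<And>m S. S \<subseteq> K \<Longrightarrow> (\<Sum>h\<in>K \<rightarrow>\<^sub>E cube m. of_bool (class_size m K h S < (1 - \<eta>) * m / P))
        \<le> 2 ^ (m * k) * \<rho>2 ^ m"
    by (fact small_class_bound[OF assms(1,3,4), folded k_def, folded P_def])
  \<comment> \<open>The first part is the error in the probability that all class sizes are even.
    The second is the rare event of a small class, magnified by the normalization of the density;
    the magnification is only polynomial in \<open>n\<close> (\<open>inv_b\<close>).\<close>
  define e where "e = (\<lambda>n. Y ^ Q * \<rho>1 ^ (2 * n) + P * ((4 * real n) ^ Q * \<rho>2 ^ (2 * n)))"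
  have pow_lim: "(\<lambda>n. (4 * real n) ^ Q * \<rho> ^ (2 * n)) \<longlonglongrightarrow> 0" if "0 \<le> \<rho>" "\<rho> < 1" for \<rho> :: real
  proof (cases "\<rho> = 0")
    case True
    have "\<forall>\<^sub>F n in sequentially. (4 * real n) ^ Q * \<rho> ^ (2 * n) = 0"
      using eventually_gt_at_top[of 0] by eventually_elim (use True in simp)
    then show ?thesis
      by (rule tendsto_eventually)
  next
    case False
    with that show ?thesis
      by real_asymp
  qed
  have "(\<lambda>n. \<rho>1 ^ (2 * n)) \<longlonglongrightarrow> 0"
    unfolding power_mult using \<rho>1(1,2) by (intro LIMSEQ_realpow_zero) (auto simp: power_less_one_iff)
  then have "e \<longlonglongrightarrow> Y ^ Q * 0 + P * 0"
    unfolding e_def by (intro tendsto_intros pow_lim \<rho>2)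
  then have "e \<longlonglongrightarrow> 0"
    by simp
  moreover have "gowers_sum (2 * n) K (\<lambda>_. middle_density n) / 2 ^ (2 * n * (k + 1)) \<le> C / (1 - \<eta>) ^ Q + e n"
    if n: "n > 0" for n
  proof -
    define b where "b = central_prob (2 * n)"
    define m where "m = 2 * n"
    have b_sq: "1 \<le> 4 * n * b\<^sup>2"
      using central_prob_ge[OF n] by (simp add: b_def)
    then have b: "b > 0"
      using central_prob_nonneg[of "2 * n"] by (cases "b = 0") (auto simp: b_def)
    have inv_b: "1 / b ^ 2 ^ k \<le> (4 * real n) ^ Q"
    proof -
      have "1 / b\<^sup>2 \<le> 4 * real n"
        using b_sq b by (simp add: divide_le_eq)
      then have "(1 / b\<^sup>2) ^ Q \<le> (4 * real n) ^ Q"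
        by (intro power_mono) auto
      then show ?thesis
        by (simp add: k(2) power_mult power_divide)
    qed
    have "(\<Sum>h\<in>K \<rightarrow>\<^sub>E cube m. card {x \<in> cube m.
        \<forall>T\<in>Pow K. 2 * hamming_weight m (\<lambda>i. x i + (\<Sum>j\<in>T. h j i)) = m} / 2 ^ m)
      \<le> (\<Sum>h\<in>K \<rightarrow>\<^sub>E cube m. of_bool (\<forall>S\<in>Pow K. even (class_size m K h S)) * (b ^ 2 ^ k * Y ^ Q) +
          (\<Sum>S\<in>Pow K. of_bool (class_size m K h S < (1 - \<eta>) * m / P)))"
      using prod_central_prob_le[OF assms n] unfolding m_def b_def Y_def Q_def P_def k_def
      by (intro sum_mono order_trans[OF card_balanced_le[OF assms(1)]]) simp
    also have "\<dots> = (\<Sum>h\<in>K \<rightarrow>\<^sub>E cube m. of_bool (\<forall>S\<in>Pow K. even (class_size m K h S))) * (b ^ 2 ^ k * Y ^ Q) +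
        (\<Sum>S\<in>Pow K. \<Sum>h\<in>K \<rightarrow>\<^sub>E cube m. of_bool (class_size m K h S < (1 - \<eta>) * m / P))"
      unfolding sum.distrib sum_distrib_right by (subst sum.swap) simp
    also have "\<dots> \<le> 2 ^ (m * k) * (2 / 2 ^ 2 ^ k + \<rho>1 ^ m) * (b ^ 2 ^ k * Y ^ Q) +
        (\<Sum>S\<in>Pow K. 2 ^ (m * k) * \<rho>2 ^ m)"
      using b Y by (intro add_mono mult_right_mono sum_mono \<rho>1(3) \<rho>2(3)) auto
    also have "\<dots> = 2 ^ (m * k) * ((2 / 2 ^ 2 ^ k + \<rho>1 ^ m) * (b ^ 2 ^ k * Y ^ Q) + P * \<rho>2 ^ m)"
      using P(2) by (simp add: algebra_simps)
    finally have bound: "(\<Sum>h\<in>K \<rightarrow>\<^sub>E cube m. card {x \<in> cube m.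
        \<forall>T\<in>Pow K. 2 * hamming_weight m (\<lambda>i. x i + (\<Sum>j\<in>T. h j i)) = m} / 2 ^ m) \<le> \<dots>" .
    have "gowers_sum m K (\<lambda>_. middle_density n) / 2 ^ (m * (k + 1)) =
        (\<Sum>h\<in>K \<rightarrow>\<^sub>E cube m. card {x \<in> cube m.
          \<forall>T\<in>Pow K. 2 * hamming_weight m (\<lambda>i. x i + (\<Sum>j\<in>T. h j i)) = m} / 2 ^ m) / 2 ^ (m * k) / b ^ 2 ^ k"
      using gowers_sum_middle_density[OF assms(1), of n]
      by (simp add: m_def b_def k_def sum_divide_distrib power_add mult_ac)
    also have "\<dots> \<le> 2 ^ (m * k) * ((2 / 2 ^ 2 ^ k + \<rho>1 ^ m) * (b ^ 2 ^ k * Y ^ Q) + P * \<rho>2 ^ m)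
        / 2 ^ (m * k) / b ^ 2 ^ k"
      using b by (intro divide_right_mono bound) auto
    also have "\<dots> = 2 / 2 ^ 2 ^ k * Y ^ Q + Y ^ Q * \<rho>1 ^ m + P * \<rho>2 ^ m * (1 / b ^ 2 ^ k)"
      using b by (simp add: field_simps)
    also have "\<dots> \<le> 2 / 2 ^ 2 ^ k * Y ^ Q + Y ^ Q * \<rho>1 ^ m + P * \<rho>2 ^ m * (4 * real n) ^ Q"
      using inv_b P \<rho>2 by (intro add_left_mono mult_left_mono) auto
    also have "\<dots> = 2 / 2 ^ 2 ^ k * Y ^ Q + e n"
      by (simp add: e_def m_def)
    \<comment> \<open>Here the constant of the middle slice is compared with the number of parity
      relations.\<close>
    also have "2 / 2 ^ 2 ^ k * Y ^ Q \<le> C / (1 - \<eta>) ^ Q"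
    proof -
      have "real (2 * 2 ^ (k * 2 ^ (k - 1))) \<le> real (card (parity_relations (2 ^ (k - 1)) K) * 2 ^ 2 ^ k)"
        using card_parity_relations_ge[OF assms(1,2)] unfolding k_def of_nat_le_iff .
      then have "2 * P ^ Q \<le> C * 2 ^ 2 ^ k"
        by (simp add: P_def Q_def C_def power_mult)
      then have "2 / 2 ^ 2 ^ k * P ^ Q \<le> C"
        by (simp add: divide_le_eq)
      then have "2 / 2 ^ 2 ^ k * P ^ Q / (1 - \<eta>) ^ Q \<le> C / (1 - \<eta>) ^ Q"
        using assms by (intro divide_right_mono) auto
      then show ?thesis
        by (simp add: Y_def power_divide)
    qed
    finally show ?thesis
      by (simp add: m_def)
  qed
  ultimately show ?thesis
    using that[of e] by (simp add: C_def Q_def k_def)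
qed

section \<open>Comparison of the two densities\<close>

lemma card_middle_slice: "card (middle_slice n) = 2 ^ (2 * n) * central_prob (2 * n)"
proof -
  have "bij_betw (\<lambda>x. {i. i < 2 * n \<and> x i = 1}) (middle_slice n) {A. A \<subseteq> {..<2 * n} \<and> card A = n}"
    by (rule bij_betwI[where g = "\<lambda>A i. of_bool (i \<in> A)"])
      (auto simp: middle_slice_def cube_def hamming_weight_def fun_eq_iff not_less[symmetric]
        intro!: arg_cong[where f = card])
  then have "card (middle_slice n) = (2 * n choose n)"
    by (simp add: bij_betw_same_card n_subsets)
  then show ?thesis
    by (simp add: central_prob_def)
qed

lemma sum_middle_density:
  assumes "n > 0"
  shows "(\<Sum>x\<in>cube (2 * n). middle_density n x) = 2 ^ (2 * n)"
proof -
  have "central_prob (2 * n) \<noteq> 0"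
    using central_prob_ge[OF assms] by auto
  moreover have "cube (2 * n) \<inter> middle_slice n = middle_slice n"
    by (auto simp: middle_slice_def)
  ultimately show ?thesis
    by (simp add: middle_density_def card_middle_slice finite_cube sum.inter_restrict[symmetric]
        indicator_def of_bool_def sum.If_cases flip: sum_divide_distrib)
qed

definition residue_slice :: "nat \<Rightarrow> nat \<Rightarrow> nat \<Rightarrow> (nat \<Rightarrow> bit) set" where
  "residue_slice M m n = {x \<in> cube m. int M dvd int (hamming_weight m x) - int n}"

definition residue_density :: "nat \<Rightarrow> nat \<Rightarrow> nat \<Rightarrow> (nat \<Rightarrow> bit) \<Rightarrow> real" where
  "residue_density M m n x = indicator (residue_slice M m n) x * 2 ^ m / card (residue_slice M m n)"

lemma sum_residue_density:
  assumes "card (residue_slice M m n) > 0"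
  shows "(\<Sum>x\<in>cube m. residue_density M m n x) = 2 ^ m"
proof -
  have "cube m \<inter> residue_slice M m n = residue_slice M m n"
    by (auto simp: residue_slice_def)
  then show ?thesis
    using assms
    by (simp add: residue_density_def finite_cube indicator_def of_bool_def sum.If_cases
        flip: sum_divide_distrib sum_distrib_right)
qed

text \<open>The quotient \<open>p\<close> compares the density of the residue class with its limit
  \<open>1 / M\<close>. The factor \<open>p ^ card X\<close> removes the normalization at the
  vertices other than \<open>{}\<close>, leaving an average of the quantity estimated in
  \<open>card_mod_completions_asymp\<close>.\<close>

lemma gowers_sum_residue_density:
  fixes K :: "nat set"
  assumes "finite K" "M > 0" "card (residue_slice M m n) > 0"
  defines "X \<equiv> Pow K - {{}}" and "p \<equiv> real (M * card (residue_slice M m n)) / 2 ^ m"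
  shows "p ^ card X * (gowers_sum m K (\<lambda>T. if T = {} then f else residue_density M m n) / 2 ^ (m * (card K + 1))) =
    (\<Sum>x\<in>cube m. f x * (real (M ^ card X * card (mod_completions m M K n x)) / 2 ^ (m * card K))) / 2 ^ m"
proof -
  let ?D = "residue_slice M m n"
  have p: "p > 0"
    using assms by (simp add: p_def)
  have finD: "finite (K \<rightarrow>\<^sub>E cube m)"
    using assms(1) by (intro finite_PiE) (auto simp: finite_cube)
  have "gowers_sum m K (\<lambda>T. if T = {} then f else residue_density M m n) =
      (\<Sum>x\<in>cube m. \<Sum>h\<in>K \<rightarrow>\<^sub>E cube m. f x * (of_bool (h \<in> mod_completions m M K n x) * (M / p) ^ card X))"
    unfolding gowers_sum_split_empty[OF assms(1)] X_def[symmetric]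
  proof (intro sum.cong refl arg_cong2[where f = times])
    fix x h assume xh: "x \<in> cube m" "h \<in> K \<rightarrow>\<^sub>E cube m"
    have "residue_density M m n (\<lambda>i. x i + (\<Sum>j\<in>T. h j i)) =
        of_bool (int M dvd int (hamming_weight m (\<lambda>i. x i + (\<Sum>j\<in>T. h j i))) - int n) * (M / p)"
      if "T \<in> X" for T
      using cube_shift[OF xh, of T] that assms(2)
      by (auto simp: residue_density_def residue_slice_def indicator_def X_def p_def)
    then have "(\<Prod>T\<in>X. residue_density M m n (\<lambda>i. x i + (\<Sum>j\<in>T. h j i))) =
        (\<Prod>T\<in>X. of_bool (int M dvd int (hamming_weight m (\<lambda>i. x i + (\<Sum>j\<in>T. h j i))) - int n) * (M / p))"
      by (intro prod.cong) auto
    also have "\<dots> = of_bool (h \<in> mod_completions m M K n x) * (M / p) ^ card X"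
      using xh assms(1) unfolding prod.distrib by (auto simp: mod_completions_def X_def)
    finally show "(\<Prod>T\<in>X. residue_density M m n (\<lambda>i. x i + (\<Sum>j\<in>T. h j i))) = \<dots>" .
  qed
  also have "\<dots> = (\<Sum>x\<in>cube m. f x * (card (mod_completions m M K n x) * (M / p) ^ card X))"
  proof -
    have "(\<Sum>h\<in>K \<rightarrow>\<^sub>E cube m. of_bool (h \<in> mod_completions m M K n x)) =
        real (card (mod_completions m M K n x))" for x
    proof -
      have "(K \<rightarrow>\<^sub>E cube m) \<inter> mod_completions m M K n x = mod_completions m M K n x"
        by (auto simp: mod_completions_def)
      then show ?thesis
        using finD by (simp add: of_bool_def sum.If_cases)
    qed
    then show ?thesis
      by (simp flip: sum_distrib_left sum_distrib_right)
  qed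
  finally have eq: "gowers_sum m K (\<lambda>T. if T = {} then f else residue_density M m n) = \<dots>" .
  have "p ^ card X * (M / p) ^ card X = real M ^ card X"
    using p by (simp flip: power_mult_distrib)
  then have "p ^ card X * (f x * (c * (M / p) ^ card X)) = f x * (real M ^ card X * c)" for x c
    by (metis mult.assoc mult.commute)
  then have "p ^ card X * (\<Sum>x\<in>cube m. f x * (card (mod_completions m M K n x) * (M / p) ^ card X)) =
      (\<Sum>x\<in>cube m. f x * (real M ^ card X * card (mod_completions m M K n x)))"
    by (simp only: sum_distrib_left)
  then have "p ^ card X * (gowers_sum m K (\<lambda>T. if T = {} then f else residue_density M m n)
      / 2 ^ (m * (card K + 1))) =
      (\<Sum>x\<in>cube m. f x * (real M ^ card X * card (mod_completions m M K n x))) / 2 ^ (m * (card K + 1))"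
    unfolding eq by simp
  then show ?thesis
    by (simp add: sum_divide_distrib power_add mult_ac)
qed

text \<open>All base points in the support of \<open>f n\<close> have nearly the same normalized
  number of completions, so the limit sees only the mean of \<open>f n\<close>. This is why pairing
  with either density gives the same limit.\<close>

lemma gowers_sum_residue_density_asymp:
  fixes K :: "nat set"
  assumes "finite K" "M > 0"
    and f: "\<And>n x. n > 0 \<Longrightarrow> 0 \<le> f n x" "\<And>n x. f n x \<noteq> 0 \<Longrightarrow> x \<in> residue_slice M (2 * n) n"
    and sum_f: "\<forall>\<^sub>F n in sequentially. (\<Sum>x\<in>cube (2 * n). f n x) = 2 ^ (2 * n)"
    and p: "(\<lambda>n. real (M * card (residue_slice M (2 * n) n)) / 2 ^ (2 * n)) \<longlonglongrightarrow> 1"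
  shows "(\<lambda>n. gowers_sum (2 * n) K (\<lambda>T. if T = {} then f n else residue_density M (2 * n) n)
      / 2 ^ (2 * n * (card K + 1))) \<longlonglongrightarrow> card (parity_relations M K)"
proof -
  define X where "X = Pow K - {{}}"
  define C where "C = real (card (parity_relations M K))"
  define p where "p = (\<lambda>n. real (M * card (residue_slice M (2 * n) n)) / 2 ^ (2 * n))"
  define G where "G = (\<lambda>n. gowers_sum (2 * n) K (\<lambda>T. if T = {} then f n else residue_density M (2 * n) n)
      / 2 ^ (2 * n * (card K + 1)))"
  define t where "t = (\<lambda>n x. real (M ^ card X * card (mod_completions (2 * n) M K n x)) / 2 ^ (2 * n * card K))"
  obtain \<rho> :: real where \<rho>: "0 \<le> \<rho>" "\<rho> < 1"
    "\<And>m n x. int M dvd int (hamming_weight m x) - int n \<Longrightarrow>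
      \<bar>real (M ^ card X * card (mod_completions m M K n x)) / 2 ^ (m * card K) - C\<bar>
        \<le> real M ^ card X * \<rho> ^ m"
    by (fact card_mod_completions_asymp[OF assms(1,2), folded X_def, folded C_def])
  have p_lim: "p \<longlonglongrightarrow> 1"
    using p by (simp add: p_def)
  then have p_pos: "\<forall>\<^sub>F n in sequentially. p n > 0"
    by (rule order_tendstoD) simp
  have "(\<lambda>n. p n ^ card X * G n - C) \<longlonglongrightarrow> 0"
  proof (rule Lim_null_comparison)
    have "(\<lambda>n. \<rho> ^ (2 * n)) \<longlonglongrightarrow> 0"
      unfolding power_mult using \<rho>(1,2) by (intro LIMSEQ_realpow_zero) (auto simp: power_less_one_iff)
    then show "(\<lambda>n. real M ^ card X * \<rho> ^ (2 * n)) \<longlonglongrightarrow> 0"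
      by (rule tendsto_mult_right_zero)
    show "\<forall>\<^sub>F n in sequentially. norm (p n ^ card X * G n - C) \<le> real M ^ card X * \<rho> ^ (2 * n)"
      using p_pos sum_f eventually_gt_at_top[of 0]
    proof eventually_elim
      case (elim n)
      have "card (residue_slice M (2 * n) n) > 0"
        using elim(1) by (cases "card (residue_slice M (2 * n) n) = 0") (auto simp: p_def)
      from gowers_sum_residue_density[OF assms(1,2) this, where f = "f n"]
      have "p n ^ card X * G n = (\<Sum>x\<in>cube (2 * n). f n x * t n x) / 2 ^ (2 * n)"
        by (simp add: p_def G_def t_def X_def)
      \<comment> \<open>Since \<open>f n\<close> has mean 1, \<open>C\<close> can be moved under the
        average.\<close>
      also have "\<dots> - C = (\<Sum>x\<in>cube (2 * n). f n x * (t n x - C)) / 2 ^ (2 * n)"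
        using elim(2) by (simp add: right_diff_distrib sum_subtractf diff_divide_distrib flip: sum_distrib_right)
      also have "norm \<dots> \<le> (\<Sum>x\<in>cube (2 * n). f n x * (real M ^ card X * \<rho> ^ (2 * n))) / 2 ^ (2 * n)"
      proof -
        have "\<bar>\<Sum>x\<in>cube (2 * n). f n x * (t n x - C)\<bar> \<le>
            (\<Sum>x\<in>cube (2 * n). f n x * (real M ^ card X * \<rho> ^ (2 * n)))"
        proof (rule order_trans[OF sum_abs sum_mono])
          fix x
          show "\<bar>f n x * (t n x - C)\<bar> \<le> f n x * (real M ^ card X * \<rho> ^ (2 * n))"
          proof (cases "f n x = 0")
            case False
            then have "\<bar>t n x - C\<bar> \<le> real M ^ card X * \<rho> ^ (2 * n)"
              unfolding t_def using f(2)[of n x] by (intro \<rho>(3)) (auto simp: residue_slice_def)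
            then show ?thesis
              using f(1)[OF elim(3), of x] by (simp add: abs_mult mult_left_mono)
          qed simp
        qed
        then show ?thesis
          by (simp add: divide_right_mono)
      qed
      also have "\<dots> = real M ^ card X * \<rho> ^ (2 * n)"
        using elim(2) by (simp flip: sum_distrib_right)
      finally show ?case .
    qed
  qed
  then have "(\<lambda>n. p n ^ card X * G n) \<longlonglongrightarrow> C"
    by (simp add: LIM_zero_iff)
  then have "(\<lambda>n. (p n ^ card X * G n) / p n ^ card X) \<longlonglongrightarrow> C / 1 ^ card X"
    using p_lim by (intro tendsto_intros) auto
  moreover have "\<forall>\<^sub>F n in sequentially. (p n ^ card X * G n) / p n ^ card X = G n"
    using p_pos by eventually_elim simp
  ultimately have "G \<longlonglongrightarrow> C"
    by (simp add: tendsto_cong)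
  then show ?thesis
    by (simp add: G_def C_def)
qed

text \<open>\<open>U\<close>, \<open>D\<close>, \<open>V\<close> and \<open>F\<close> stand for the
  normalized Gowers sums of \<open>u\<close>, \<open>d\<close>, \<open>u + d\<close> and
  \<open>u - d\<close>, and \<open>L\<close> for the product with \<open>u\<close> at
  \<open>{}\<close> and \<open>d\<close> elsewhere. For small \<delta> the pairing bounds
  \<open>V\<close> below by almost \<open>2 ^ P * C\<close>, while \<open>V + F\<close> is at most
  slightly more than that; \<open>\<phi> \<delta>\<close> is the remaining gap.\<close>

lemma Clarkson_squeeze:
  fixes U D L V F :: "nat \<Rightarrow> real" and P Q :: nat and C :: real
  assumes "C > 0" "P > 0"
    and sum_le: "\<forall>\<^sub>F n in sequentially. V n + F n \<le> 2 ^ P * max (U n) (D n)"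
    and pairing: "\<And>s. \<forall>\<^sub>F n in sequentially. s * (L n + D n) \<le> max (s ^ P * V n) (D n)"
    and U: "\<And>\<eta>. 0 < \<eta> \<Longrightarrow> \<eta> < 1 \<Longrightarrow>
      \<exists>e. e \<longlonglongrightarrow> 0 \<and> (\<forall>\<^sub>F n in sequentially. U n \<le> C / (1 - \<eta>) ^ Q + e n)"
    and L: "L \<longlonglongrightarrow> C" and D: "D \<longlonglongrightarrow> C" and "\<epsilon> > 0"
  shows "\<forall>\<^sub>F n in sequentially. F n \<le> \<epsilon>"
proof -
  \<comment> \<open>At the value 1/2 both entries of the maximum in \<open>pairing\<close> could be
    in balance in the limit. The surplus in \<delta> forces the entry with \<open>V\<close> to be
    the larger one, see \<open>ev4\<close>.\<close>
  define s :: "real \<Rightarrow> real" where "s = (\<lambda>\<delta>. (1 + \<delta>) / 2)"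
  define \<phi> where "\<phi> = (\<lambda>\<delta>. 2 ^ P * (C / (1 - \<delta>) ^ Q + \<delta>) - s \<delta> * (2 * C - \<delta>) / s \<delta> ^ P)"
  have "\<phi> 0 = 0"
    using assms(2) by (cases P) (auto simp: \<phi>_def s_def power_divide)
  moreover have "(\<phi> \<longlongrightarrow> \<phi> 0) (at_right 0)"
    unfolding \<phi>_def s_def by (auto intro!: tendsto_eq_intros)
  ultimately have "\<forall>\<^sub>F \<delta> in at_right 0. \<phi> \<delta> < \<epsilon>"
    using \<open>\<epsilon> > 0\<close> by (auto dest: order_tendstoD)
  moreover have "\<forall>\<^sub>F \<delta> in at_right (0 :: real). 0 < \<delta> \<and> \<delta> < 1"
    by (intro eventually_conj eventually_at_right_less) (auto simp: eventually_at_right_field intro: exI[of _ 1])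
  ultimately have "\<forall>\<^sub>F \<delta> in at_right 0. \<phi> \<delta> < \<epsilon> \<and> 0 < \<delta> \<and> \<delta> < 1"
    by eventually_elim simp
  then obtain \<delta> where \<delta>: "\<phi> \<delta> < \<epsilon>" "0 < \<delta>" "\<delta> < 1"
    using eventually_happens'[OF trivial_limit_at_right_real] by blast
  obtain e where e: "e \<longlonglongrightarrow> 0" "\<forall>\<^sub>F n in sequentially. U n \<le> C / (1 - \<delta>) ^ Q + e n"
    using U[OF \<delta>(2,3)] by blast
  have LD: "(\<lambda>n. L n + D n) \<longlonglongrightarrow> C + C"
    by (intro tendsto_intros L D)
  have ev1: "\<forall>\<^sub>F n in sequentially. e n < \<delta>"
    by (rule order_tendstoD(2)[OF e(1)]) (use \<delta> in simp)
  have ev2: "\<forall>\<^sub>F n in sequentially. D n < C + \<delta>"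
    by (rule order_tendstoD(2)[OF D]) (use \<delta> in simp)
  have ev3: "\<forall>\<^sub>F n in sequentially. 2 * C - \<delta> < L n + D n"
    by (rule order_tendstoD(1)[OF LD]) (use \<delta> in simp)
  have "(\<lambda>n. s \<delta> * (L n + D n) - D n) \<longlonglongrightarrow> s \<delta> * (C + C) - C"
    by (intro tendsto_intros LD D)
  moreover have "s \<delta> * (C + C) - C > 0"
    using \<delta> assms(1) by (simp add: s_def field_simps)
  ultimately have ev4: "\<forall>\<^sub>F n in sequentially. 0 < s \<delta> * (L n + D n) - D n"
    by (rule order_tendstoD)
  have s_pos: "s \<delta> > 0"
    using \<delta> by (simp add: s_def)
  have C_le: "C \<le> C / (1 - \<delta>) ^ Q"
    using \<delta> assms(1) by (simp add: le_divide_eq power_le_one)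
  from sum_le pairing[of "s \<delta>"] e(2) ev1 ev2 ev3 ev4 show ?thesis
  proof eventually_elim
    case (elim n)
    have "s \<delta> * (2 * C - \<delta>) \<le> s \<delta> * (L n + D n)"
      using elim(6) s_pos by (intro mult_left_mono) auto
    also have "\<dots> \<le> s \<delta> ^ P * V n"
      using elim(2,7) by linarith
    finally have "s \<delta> * (2 * C - \<delta>) / s \<delta> ^ P \<le> V n"
      using s_pos by (simp add: divide_le_eq mult.commute)
    moreover have "2 ^ P * max (U n) (D n) \<le> 2 ^ P * (C / (1 - \<delta>) ^ Q + \<delta>)"
      using elim(3,4,5) C_le by (intro mult_left_mono) auto
    moreover have "V n + F n \<le> 2 ^ P * max (U n) (D n)"
      by (rule elim(1))
    ultimately have "F n \<le> \<phi> \<delta>"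
      unfolding \<phi>_def by linarith
    then show ?case
      using \<delta>(1) by simp
  qed
qed

lemma gowers_norm_of_real:
  "gowers_norm m k (\<lambda>x. of_real (f x)) =
    root (2 ^ k) \<bar>gowers_sum m {1..k} (\<lambda>_. f) / 2 ^ (m * (k + 1))\<bar>"
proof -
  have cnj: "(cnj ^^ c) (of_real r) = of_real r" for c r
    by (induction c) auto
  have "uniform_avg (cube m \<times> ({1..k} \<rightarrow>\<^sub>E cube m))
      (\<lambda>(x, h). \<Prod>T\<in>Pow {1..k}. (cnj ^^ card T) (of_real (f (\<lambda>i. x i + (\<Sum>j\<in>T. h j i))))) =
    of_real (gowers_sum m {1..k} (\<lambda>_. f) / 2 ^ (m * (k + 1)))"
    by (simp add: uniform_avg_def cnj gowers_sum_def sum.cartesian_product[symmetric]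
        card_cartesian_product card_cube card_directions power_add mult.commute)
  then show ?thesis
    unfolding gowers_norm_def by (simp only: norm_of_real)
qed

lemma residue_density_tendsto_one:
  assumes "M > 0"
  shows "(\<lambda>n. real (M * card (residue_slice M (2 * n) n)) / 2 ^ (2 * n)) \<longlonglongrightarrow> 1"
proof -
  obtain \<rho> :: real where \<rho>: "0 \<le> \<rho>" "\<rho> < 1"
    "\<And>m n. \<bar>real (M * card {x \<in> cube m. int M dvd int (hamming_weight m x) - int n}) / 2 ^ m - 1\<bar>
      \<le> M * \<rho> ^ m"
    by (fact mod_slice_density_asymp[OF assms])
  have "(\<lambda>n. \<rho> ^ (2 * n)) \<longlonglongrightarrow> 0"
    unfolding power_mult using \<rho>(1,2) by (intro LIMSEQ_realpow_zero) (auto simp: power_less_one_iff)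
  then have "(\<lambda>n. M * \<rho> ^ (2 * n)) \<longlonglongrightarrow> 0"
    by (rule tendsto_mult_right_zero)
  moreover have "\<forall>\<^sub>F n in sequentially.
      norm (real (M * card (residue_slice M (2 * n) n)) / 2 ^ (2 * n) - 1) \<le> M * \<rho> ^ (2 * n)"
    using \<rho>(3) by (simp add: residue_slice_def)
  ultimately show ?thesis
    by (subst LIM_zero_iff[symmetric]) (rule Lim_null_comparison)
qed

lemma middle_slice_subset_residue_slice: "middle_slice n \<subseteq> residue_slice M (2 * n) n"
  by (auto simp: middle_slice_def residue_slice_def)

lemma gowers_sum_diff_tendsto_zero:
  fixes K :: "nat set"
  assumes "finite K" "K \<noteq> {}" "\<epsilon> > 0"
  defines "M \<equiv> 2 ^ (card K - 1)"
  shows "\<forall>\<^sub>F n in sequentially.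
    gowers_sum (2 * n) K (\<lambda>_ x. middle_density n x - residue_density M (2 * n) n x)
      / 2 ^ (2 * n * (card K + 1)) \<le> \<epsilon>"
proof -
  define P where "P = (2 :: nat) ^ card K"
  define u where "u = middle_density"
  define d where "d = (\<lambda>n. residue_density M (2 * n) n)"
  define N :: "nat \<Rightarrow> real" where "N = (\<lambda>n. 2 ^ (2 * n * (card K + 1)))"
  define C where "C = real (card (parity_relations M K))"
  have M: "M > 0"
    by (simp add: M_def)
  have N: "N n > 0" for n
    by (simp add: N_def)
  have p_lim: "(\<lambda>n. real (M * card (residue_slice M (2 * n) n)) / 2 ^ (2 * n)) \<longlonglongrightarrow> 1"
    by (rule residue_density_tendsto_one[OF M])
  have "\<forall>\<^sub>F n in sequentially. 0 < real (M * card (residue_slice M (2 * n) n)) / 2 ^ (2 * n)"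
    by (rule order_tendstoD(1)[OF p_lim]) simp
  then have sum_d: "\<forall>\<^sub>F n in sequentially. (\<Sum>x\<in>cube (2 * n). d n x) = 2 ^ (2 * n)"
  proof eventually_elim
    case (elim n)
    then have "card (residue_slice M (2 * n) n) > 0"
      by (cases "card (residue_slice M (2 * n) n) = 0") auto
    then show ?case
      unfolding d_def by (rule sum_residue_density)
  qed
  have sum_u: "\<forall>\<^sub>F n in sequentially. (\<Sum>x\<in>cube (2 * n). u n x) = 2 ^ (2 * n)"
    using eventually_gt_at_top[of 0] by eventually_elim (simp add: u_def sum_middle_density)
  \<comment> \<open>The middle slice is contained in the residue class, so its density may stand at
    the base point.\<close>
  have L: "(\<lambda>n. gowers_sum (2 * n) K (\<lambda>T. if T = {} then u n else d n) / N n) \<longlonglongrightarrow> C"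
    unfolding d_def N_def C_def
  proof (rule gowers_sum_residue_density_asymp[OF assms(1) M _ _ sum_u p_lim])
    show "0 \<le> u n x" for n x
      by (simp add: u_def middle_density_def central_prob_nonneg)
    show "x \<in> residue_slice M (2 * n) n" if "u n x \<noteq> 0" for n x
      using that middle_slice_subset_residue_slice[of n M]
      by (auto simp: u_def middle_density_def indicator_def split: if_splits)
  qed
  \<comment> \<open>The trivial case distinction presents the Gowers sum of \<open>d n\<close> as a
    product of the same shape, with \<open>d n\<close> itself at the base point.\<close>
  have "(\<lambda>n. gowers_sum (2 * n) K (\<lambda>T. if T = {} then d n else d n) / N n) \<longlonglongrightarrow> C"
    unfolding N_def C_def
  proof (subst (2) d_def, rule gowers_sum_residue_density_asymp[OF assms(1) M _ _ sum_d p_lim])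
    show "0 \<le> d n x" for n x
      by (simp add: d_def residue_density_def)
    show "x \<in> residue_slice M (2 * n) n" if "d n x \<noteq> 0" for n x
      using that by (auto simp: d_def residue_density_def indicator_def split: if_splits)
  qed
  then have D: "(\<lambda>n. gowers_sum (2 * n) K (\<lambda>_. d n) / N n) \<longlonglongrightarrow> C"
    by simp
  have "C > 0"
  proof -
    have "0 < card (parity_relations M K) * 2 ^ 2 ^ card K"
      by (rule less_le_trans[OF _ card_parity_relations_ge[OF assms(1,2), folded M_def]]) simp
    then show ?thesis
      by (simp add: C_def)
  qed
  then have "\<forall>\<^sub>F n in sequentially. gowers_sum (2 * n) K (\<lambda>_ x. u n x - d n x) / N n \<le> \<epsilon>"
  proof (rule Clarkson_squeeze[where P = P and Q = "2 ^ (card K - 1)" and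
        U = "\<lambda>n. gowers_sum (2 * n) K (\<lambda>_. u n) / N n" and
        V = "\<lambda>n. gowers_sum (2 * n) K (\<lambda>_ x. u n x + d n x) / N n", OF _ _ _ _ _ L D assms(3)])
    show "P > 0"
      by (simp add: P_def)
    show "\<forall>\<^sub>F n in sequentially. gowers_sum (2 * n) K (\<lambda>_ x. u n x + d n x) / N n +
        gowers_sum (2 * n) K (\<lambda>_ x. u n x - d n x) / N n \<le>
      2 ^ P * max (gowers_sum (2 * n) K (\<lambda>_. u n) / N n) (gowers_sum (2 * n) K (\<lambda>_. d n) / N n)"
    proof (rule always_eventually, rule allI)
      fix n
      let ?U = "gowers_sum (2 * n) K (\<lambda>_. u n)" and ?D = "gowers_sum (2 * n) K (\<lambda>_. d n)"
      have "gowers_sum (2 * n) K (\<lambda>_ x. u n x + d n x) + gowers_sum (2 * n) K (\<lambda>_ x. u n x - d n x)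
          \<le> 2 ^ P * max ?U ?D"
        unfolding P_def by (rule gowers_sum_add_diff[OF assms(1,2)]) auto
      then have "(gowers_sum (2 * n) K (\<lambda>_ x. u n x + d n x) +
          gowers_sum (2 * n) K (\<lambda>_ x. u n x - d n x)) / N n \<le> 2 ^ P * max ?U ?D / N n"
        using N[of n] by (simp add: divide_right_mono)
      also have "\<dots> = 2 ^ P * max (?U / N n) (?D / N n)"
        using N[of n]
        by (simp only: max_divide_distrib_right less_imp_le if_True times_divide_eq_right[symmetric])
      finally show "gowers_sum (2 * n) K (\<lambda>_ x. u n x + d n x) / N n +
          gowers_sum (2 * n) K (\<lambda>_ x. u n x - d n x) / N n \<le> 2 ^ P * max (?U / N n) (?D / N n)"
        by (simp add: add_divide_distrib)
    qed
    show "\<forall>\<^sub>F n in sequentially. s * (gowers_sum (2 * n) K (\<lambda>T. if T = {} then u n else d n) / N n +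
        gowers_sum (2 * n) K (\<lambda>_. d n) / N n) \<le>
      max (s ^ P * (gowers_sum (2 * n) K (\<lambda>_ x. u n x + d n x) / N n))
        (gowers_sum (2 * n) K (\<lambda>_. d n) / N n)" for s
    proof (rule always_eventually, rule allI)
      fix n
      let ?L = "gowers_sum (2 * n) K (\<lambda>T. if T = {} then u n else d n)"
        and ?V = "gowers_sum (2 * n) K (\<lambda>_ x. u n x + d n x)"
        and ?D = "gowers_sum (2 * n) K (\<lambda>_. d n)"
      have "s * (?L + ?D) \<le> max (s ^ P * ?V) ?D"
        unfolding P_def by (rule gowers_sum_pairing[OF assms(1,2)])
      then have "s * (?L + ?D) / N n \<le> max (s ^ P * ?V) ?D / N n"
        using N[of n] by (simp add: divide_right_mono)
      then show "s * (?L / N n + ?D / N n) \<le> max (s ^ P * (?V / N n)) (?D / N n)"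
        using N[of n] by (simp add: max_divide_distrib_right add_divide_distrib distrib_left)
    qed
    show "\<exists>e. e \<longlonglongrightarrow> 0 \<and> (\<forall>\<^sub>F n in sequentially.
        gowers_sum (2 * n) K (\<lambda>_. u n) / N n \<le> C / (1 - \<eta>) ^ 2 ^ (card K - 1) + e n)"
      if \<eta>: "0 < \<eta>" "\<eta> < 1" for \<eta>
    proof -
      obtain e :: "nat \<Rightarrow> real" where e: "e \<longlonglongrightarrow> 0"
        "\<And>n. n > 0 \<Longrightarrow> gowers_sum (2 * n) K (\<lambda>_. middle_density n) / 2 ^ (2 * n * (card K + 1)) \<le>
          card (parity_relations (2 ^ (card K - 1)) K) / (1 - \<eta>) ^ 2 ^ (card K - 1) + e n"
        by (fact gowers_middle_density_bound[OF assms(1,2) \<eta>])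
      have "\<forall>\<^sub>F n in sequentially.
          gowers_sum (2 * n) K (\<lambda>_. u n) / N n \<le> C / (1 - \<eta>) ^ 2 ^ (card K - 1) + e n"
        using eventually_gt_at_top[of 0] by eventually_elim (use e(2) in \<open>simp add: u_def N_def C_def M_def\<close>)
      with e(1) show ?thesis
        by blast
    qed
  qed
  then show ?thesis
    by (simp add: u_def d_def N_def)
qed

section \<open>Identification with the normalized indicators\<close>

lemma uniform_avg_indicator:
  assumes "A \<subseteq> cube m"
  shows "uniform_avg (cube m) (indicator A) = of_real (card A / 2 ^ m)"
proof -
  have "cube m \<inter> A = A"
    using assms by auto
  then show ?thesis
    by (simp add: uniform_avg_def card_cube finite_cube indicator_def of_bool_def sum.If_cases)
qed

lemma normalized_indicator_middle_slice:
  "normalized_indicator (2 * n) (middle_slice n) x = of_real (middle_density n x)"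
proof -
  have "middle_slice n \<subseteq> cube (2 * n)"
    by (auto simp: middle_slice_def)
  then show ?thesis
    by (simp add: normalized_indicator_def uniform_avg_indicator card_middle_slice middle_density_def
        indicator_def)
qed

lemma normalized_indicator_mod_slice:
  assumes "[int n = a] (mod 2 ^ (k - 1))"
  shows "normalized_indicator (2 * n) (mod_slice n k a) x =
    of_real (residue_density (2 ^ (k - 1)) (2 * n) n x)"
proof -
  have "[int w = a] (mod 2 ^ (k - 1)) \<longleftrightarrow> int (2 ^ (k - 1)) dvd int w - int n" for w
  proof -
    have "[int w = a] (mod 2 ^ (k - 1)) \<longleftrightarrow> [int w = int n] (mod 2 ^ (k - 1))"
      using assms by (metis cong_sym cong_trans)
    then show ?thesis
      by (simp add: cong_iff_dvd_diff)
  qed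
  then have "mod_slice n k a = residue_slice (2 ^ (k - 1)) (2 * n) n"
    by (simp add: mod_slice_def residue_slice_def)
  moreover have "residue_slice (2 ^ (k - 1)) (2 * n) n \<subseteq> cube (2 * n)"
    by (auto simp: residue_slice_def)
  ultimately show ?thesis
    by (simp add: normalized_indicator_def uniform_avg_indicator residue_density_def indicator_def)
qed

theorem theorem1p2:
  fixes k :: nat and \<epsilon> :: real
  assumes "k \<ge> 1" and "\<epsilon> > 0"
  shows "\<exists>n0::nat. n0 > 0 \<and> (\<forall>n>n0. \<forall>a::int. [int n = a] (mod 2 ^ (k - 1)) \<longrightarrow>
           gowers_norm (2 * n) k
             (\<lambda>x. normalized_indicator (2 * n) (middle_slice n) x
                - normalized_indicator (2 * n) (mod_slice n k a) x) \<le> \<epsilon>)"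
proof -
  define f where "f = (\<lambda>n x. middle_density n x - residue_density (2 ^ (k - 1)) (2 * n) n x)"
  define G where "G = (\<lambda>n. gowers_sum (2 * n) {1..k} (\<lambda>_. f n) / 2 ^ (2 * n * (k + 1)))"
  \<comment> \<open>The \<open>2 ^ k\<close>-th root in the norm will turn this bound into
    \<epsilon>.\<close>
  have "\<forall>\<^sub>F n in sequentially. G n \<le> \<epsilon> ^ 2 ^ k"
    using gowers_sum_diff_tendsto_zero[of "{1..k}" "\<epsilon> ^ 2 ^ k"] assms by (simp add: G_def f_def)
  then obtain n1 where n1: "\<And>n. n \<ge> n1 \<Longrightarrow> G n \<le> \<epsilon> ^ 2 ^ k"
    by (auto simp: eventually_sequentially)
  have "gowers_norm (2 * n) k
      (\<lambda>x. normalized_indicator (2 * n) (middle_slice n) x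
        - normalized_indicator (2 * n) (mod_slice n k a) x) \<le> \<epsilon>"
    if n: "n > Suc n1" and a: "[int n = a] (mod 2 ^ (k - 1))" for n a
  proof -
    have "0 \<le> G n"
      using gowers_sum_const_nonneg[of "{1..k}" "2 * n" "f n"] assms by (simp add: G_def)
    have "gowers_norm (2 * n) k
        (\<lambda>x. normalized_indicator (2 * n) (middle_slice n) x
          - normalized_indicator (2 * n) (mod_slice n k a) x) =
      gowers_norm (2 * n) k (\<lambda>x. of_real (f n x))"
      by (simp add: normalized_indicator_middle_slice normalized_indicator_mod_slice[OF a] f_def)
    also have "\<dots> = root (2 ^ k) (G n)"
      using \<open>0 \<le> G n\<close> unfolding gowers_norm_of_real G_def by (simp only: abs_of_nonneg)
    also have "\<dots> \<le> root (2 ^ k) (\<epsilon> ^ 2 ^ k)"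
      using n1[of n] n by (intro real_root_le_mono) auto
    also have "\<dots> = \<epsilon>"
      using assms by (simp add: real_root_power_cancel)
    finally show ?thesis .
  qed
  then show ?thesis
    \<comment> \<open>The successor makes the threshold positive.\<close>
    by (intro exI[of _ "Suc n1"]) auto
qed

end
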